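(* Let $\beta\in(0,1)$ be a suitable absolute constant and assume $(k/\epsilon)\log(1/\delta)\leq\beta n$. There exists a (non-adaptive, linear-measurement) $\ell_2/\ell_2$ algorithm for the spiked-covariance model which uses $\mathcal{O}\left(\frac{k}{\epsilon}\log\frac{\epsilon n}{k}+\frac{1}{\epsilon}\log\frac{1}{\delta}\right)$ measurements and, given the measurements of $x$, outputs $\hat x$ with $\|\hat x - x\|_2^2\leq(1+\epsilon)\|x_{-k}\|_2^2$ with probability at least $1-\delta$, where the probability is over both the random signal and the randomness of the algorithm.
   Context: Spiked-covariance model: choose $k$ distinct coordinates $i_1,\dots,i_k\in[n]$ uniformly at random; let $y\in\mathbb{R}^n$ have $y_{i_j}$ independent and uniform on $\{-\sqrt{\epsilon/k},+\sqrt{\epsilon/k}\}$ for $j=1,\dots,k$ and all other coordinates $0$; let $z\sim N(0,\frac1n I_n)$ independent of $y$; the signal is $x=y+z$. $x_{-k}$ is $x$ with its $k$ largest coordinates in magnitude zeroed out.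
   Formalization: The formal statement takes 0 < ε < 1 and reads log(εn/k) in the measurement bound as max(1, log(εn/k)), since the literal bound can be zero or negative for δ near 1, and for large ε it would allow no measurements. *)

theory Defs
  imports "HOL-Probability.Probability"
begin

text \<open>
  The dimension \<open>n\<close> has to be quantified below the absolute constants, so it cannot be
  a type: vectors of \<open>\<real>\<^sup>n\<close> are functions \<open>nat \<Rightarrow> real\<close>, read on
  \<open>{..<n}\<close>, and their Euclidean norm is \<open>L2_set _ {..<n}\<close>.
\<close>

abbreviation borel_vec :: "nat \<Rightarrow> (nat \<Rightarrow> real) measure" where
  "borel_vec n \<equiv> Pi\<^sub>M {..<n} (\<lambda>_. borel)"

definition sparse_part :: "nat \<Rightarrow> nat \<Rightarrow> real \<Rightarrow> (nat \<Rightarrow> real) pmf" where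
  "sparse_part n k \<epsilon> =
     bind_pmf (pmf_of_set {S. S \<subseteq> {..<n} \<and> card S = k})
       (\<lambda>S. Pi_pmf S 0 (\<lambda>_. pmf_of_set {- sqrt (\<epsilon> / real k), sqrt (\<epsilon> / real k)}))"

text \<open>The second argument of \<^const>\<open>normal_density\<close> is the standard deviation.\<close>

definition noise :: "nat \<Rightarrow> (nat \<Rightarrow> real) measure" where
  "noise n = Pi\<^sub>M {..<n} (\<lambda>_. density lborel (normal_density 0 (1 / sqrt (real n))))"

definition spiked_covariance :: "nat \<Rightarrow> nat \<Rightarrow> real \<Rightarrow> (nat \<Rightarrow> real) measure" where
  "spiked_covariance n k \<epsilon> =
     distr (measure_pmf (sparse_part n k \<epsilon>) \<Otimes>\<^sub>M noise n) (borel_vec n)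
       (\<lambda>(y, z). \<lambda>i\<in>{..<n}. y i + z i)"

text \<open>
  Ties in magnitude are broken in favour of the smaller index; the norm of
  \<open>zero_largest n k x\<close> does not depend on this choice.
\<close>

definition largest_coords :: "nat \<Rightarrow> nat \<Rightarrow> (nat \<Rightarrow> real) \<Rightarrow> nat set" where
  "largest_coords n k x =
     {i\<in>{..<n}. card {j\<in>{..<n}. \<bar>x i\<bar> < \<bar>x j\<bar> \<or> (\<bar>x j\<bar> = \<bar>x i\<bar> \<and> j < i)} < k}"

definition zero_largest :: "nat \<Rightarrow> nat \<Rightarrow> (nat \<Rightarrow> real) \<Rightarrow> nat \<Rightarrow> real" where
  "zero_largest n k x = (\<lambda>i\<in>{..<n}. if i \<in> largest_coords n k x then 0 else x i)"

text \<open>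
  A randomized non-adaptive scheme draws a seed, which fixes the whole sensing matrix before
  the signal is seen; the decoder receives the seed and the measurement vector only.
\<close>

record 'w sensing_scheme =
  seed :: "'w measure"
  sensing_matrix :: "'w \<Rightarrow> nat \<Rightarrow> nat \<Rightarrow> real"
  decoder :: "'w \<Rightarrow> (nat \<Rightarrow> real) \<Rightarrow> nat \<Rightarrow> real"

definition is_sensing_scheme :: "nat \<Rightarrow> nat \<Rightarrow> 'w sensing_scheme \<Rightarrow> bool" where
  "is_sensing_scheme m n R \<longleftrightarrow>
     prob_space (seed R) \<and>
     (\<forall>i<m. \<forall>j<n. (\<lambda>w. sensing_matrix R w i j) \<in> borel_measurable (seed R)) \<and>
     (\<lambda>(w, u). decoder R w u) \<in> seed R \<Otimes>\<^sub>M borel_vec m \<rightarrow>\<^sub>M borel_vec n"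

definition measurements ::
  "nat \<Rightarrow> nat \<Rightarrow> 'w sensing_scheme \<Rightarrow> 'w \<Rightarrow> (nat \<Rightarrow> real) \<Rightarrow> nat \<Rightarrow> real" where
  "measurements m n R w x = (\<lambda>i\<in>{..<m}. \<Sum>j<n. sensing_matrix R w i j * x j)"

definition estimate ::
  "nat \<Rightarrow> nat \<Rightarrow> 'w sensing_scheme \<Rightarrow> 'w \<Rightarrow> (nat \<Rightarrow> real) \<Rightarrow> nat \<Rightarrow> real" where
  "estimate m n R w x = decoder R w (measurements m n R w x)"

definition l2_l2_guarantee ::
  "nat \<Rightarrow> nat \<Rightarrow> real \<Rightarrow> (nat \<Rightarrow> real) \<Rightarrow> (nat \<Rightarrow> real) \<Rightarrow> bool" where
  "l2_l2_guarantee n k \<epsilon> x xhat \<longleftrightarrow>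
     (L2_set (\<lambda>i. xhat i - x i) {..<n})\<^sup>2 \<le> (1 + \<epsilon>) * (L2_set (zero_largest n k x) {..<n})\<^sup>2"

lemma prob_space_noise: "n > 0 \<Longrightarrow> prob_space (noise n)"
  unfolding noise_def by (intro prob_space_PiM prob_space_normal_density) auto

lemma sets_noise [measurable_cong]: "sets (noise n) = sets (borel_vec n)"
  unfolding noise_def by (intro sets_PiM_cong) auto

lemma measurable_spiked_sum:
  "(\<lambda>(y, z). \<lambda>i\<in>{..<n}. y i + z i)
     \<in> measure_pmf (sparse_part n k \<epsilon>) \<Otimes>\<^sub>M noise n \<rightarrow>\<^sub>M borel_vec n"
proof -
  have [measurable]: "(\<lambda>y. y i) \<in> borel_measurable (measure_pmf (sparse_part n k \<epsilon>))" for i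
    by simp
  have [measurable]: "(\<lambda>z. z i) \<in> borel_measurable (noise n)" if "i \<in> {..<n}" for i
    using that measurable_component_singleton[OF that, of "\<lambda>_. borel"]
    by (simp add: measurable_cong_sets[OF sets_noise refl])
  show ?thesis
    unfolding case_prod_beta by (rule measurable_restrict) measurable
qed

lemma sets_spiked_covariance [simp, measurable_cong]:
  "sets (spiked_covariance n k \<epsilon>) = sets (borel_vec n)"
  by (simp add: spiked_covariance_def)

lemma prob_space_spiked_covariance:
  assumes "n > 0"
  shows "prob_space (spiked_covariance n k \<epsilon>)"
proof -
  interpret Y: prob_space "measure_pmf (sparse_part n k \<epsilon>)" by (rule measure_pmf.prob_space_axioms)
  interpret Z: prob_space "noise n" using assms by (rule prob_space_noise)
  interpret pair_prob_space "measure_pmf (sparse_part n k \<epsilon>)" "noise n" ..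
  show ?thesis
    unfolding spiked_covariance_def by (rule prob_space_distr) (rule measurable_spiked_sum)
qed

lemma largest_coords_dominate:
  assumes "i \<in> largest_coords n k x" "j < n" "j \<notin> largest_coords n k x"
  shows "\<bar>x j\<bar> \<le> \<bar>x i\<bar>"
proof (rule ccontr)
  let ?P = "\<lambda>i. {j\<in>{..<n}. \<bar>x i\<bar> < \<bar>x j\<bar> \<or> (\<bar>x j\<bar> = \<bar>x i\<bar> \<and> j < i)}"
  assume "\<not> \<bar>x j\<bar> \<le> \<bar>x i\<bar>"
  then have "?P j \<subseteq> ?P i" by auto
  then have "card (?P j) \<le> card (?P i)" by (intro card_mono) auto
  with assms show False by (auto simp: largest_coords_def)
qed

lemma card_largest_coords:
  assumes "k \<le> n"
  shows "card (largest_coords n k x) = k"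
proof -
  let ?P = "\<lambda>i. {j\<in>{..<n}. \<bar>x i\<bar> < \<bar>x j\<bar> \<or> (\<bar>x j\<bar> = \<bar>x i\<bar> \<and> j < i)}"
  let ?r = "\<lambda>i. card (?P i)"
  have less: "?r i < ?r j" if "i < n" "i \<in> ?P j" for i j
    using that by (intro psubset_card_mono) auto
  have inj: "inj_on ?r {..<n}"
  proof (rule inj_onI)
    fix i j assume ij: "i \<in> {..<n}" "j \<in> {..<n}" "?r i = ?r j"
    show "i = j"
    proof (rule ccontr)
      assume "i \<noteq> j"
      then have "i \<in> ?P j \<or> j \<in> ?P i" using ij(1,2) by auto
      then show False using less[of i j] less[of j i] ij by auto
    qed
  qed
  have "?r ` {..<n} \<subseteq> {..<n}"
  proof
    fix c assume "c \<in> ?r ` {..<n}"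
    then obtain i where i: "i < n" "c = ?r i" by auto
    have "?r i < card {..<n}" using i(1) by (intro psubset_card_mono) auto
    then show "c \<in> {..<n}" using i by simp
  qed
  then have img: "?r ` {..<n} = {..<n}"
    using inj by (intro card_subset_eq) (auto simp: card_image)
  have "?r ` largest_coords n k x = {..<k}"
  proof
    show "?r ` largest_coords n k x \<subseteq> {..<k}" by (auto simp: largest_coords_def)
    show "{..<k} \<subseteq> ?r ` largest_coords n k x"
    proof
      fix c assume c: "c \<in> {..<k}"
      then have "c \<in> ?r ` {..<n}" unfolding img using assms by auto
      then obtain i where "i < n" "c = ?r i" by auto
      then show "c \<in> ?r ` largest_coords n k x" using c by (auto simp: largest_coords_def)
    qed
  qed
  moreover have "inj_on ?r (largest_coords n k x)"
    using inj by (rule inj_on_subset) (auto simp: largest_coords_def)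
  ultimately show ?thesis using card_image by fastforce
qed

end

theory Submission
  imports Defs
begin

text \<open>
  Write \<open>L = \<epsilon> * n / k\<close>. Zeroing the \<open>k\<close> largest coordinates removes at most about
  \<open>\<epsilon> + (k / n) * ln (n / k)\<close> of the energy, and two schemes compete with that.

  If \<open>L < 1 / \<epsilon>\<close>, it is enough to read off the first \<open>m\<close> coordinates: they carry a fraction
  \<open>m / n \<ge> C / L > C * \<epsilon>\<close> of the noise, which exceeds the energy of the \<open>k\<close> largest coordinates.
  If \<open>L\<close> is bounded, \<open>m\<close> can be taken to be \<open>n\<close>.

  Otherwise \<open>ln (n / k) \<le> 2 * ln L\<close>, so the budget covers a union bound over the finite set
  of possible sparse parts. For a random sign matrix \<open>A\<close> the decoder outputs the candidate \<open>y'\<close>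
  maximising the correlation of \<open>A y'\<close> with the measurements. A Chernoff bound for sums of products of
  Rademacher forms shows that the maximiser is within squared distance \<open>\<epsilon> / 8\<close> of the true sparse
  part, which is close enough because the noise on any \<open>k\<close> coordinates is much smaller than
  \<open>\<epsilon>\<close>. All probabilities over the noise reduce to tail bounds for chi-square variables.
\<close>

subsection \<open>Tail bounds for the noise\<close>

text \<open>Tilting a centred Gaussian density by \<open>exp (s * z\<^sup>2)\<close> gives another
  centred Gaussian, of variance \<sigma>^2 / (1 - 2 s \<sigma>^2), times the ratio of the
  normalising constants.\<close>

lemma nn_integral_exp_square_normal:
  fixes s \<sigma> :: real
  assumes "\<sigma> > 0" "2 * s * \<sigma>\<^sup>2 < 1"
  shows "(\<integral>\<^sup>+z. ennreal (exp (s * z\<^sup>2)) \<partial>density lborel (normal_density 0 \<sigma>)) =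
    ennreal (1 / sqrt (1 - 2 * s * \<sigma>\<^sup>2))"
proof -
  define r where "r = 1 - 2 * s * \<sigma>\<^sup>2"
  define \<tau> where "\<tau> = \<sigma> / sqrt r"
  have r: "r > 0" using assms by (simp add: r_def)
  have \<tau>: "\<tau> > 0" "\<tau>\<^sup>2 = \<sigma>\<^sup>2 / r" using r assms by (auto simp: \<tau>_def power_divide)
  have eq: "normal_density 0 \<sigma> z * exp (s * z\<^sup>2) = 1 / sqrt r * normal_density 0 \<tau> z" for z
  proof -
    have "- z\<^sup>2 / (2 * \<sigma>\<^sup>2) + s * z\<^sup>2 = - z\<^sup>2 / (2 * \<tau>\<^sup>2)"
      unfolding \<tau>(2) r_def using assms r by (simp add: field_simps r_def)
    moreover have "1 / sqrt (2 * pi * \<sigma>\<^sup>2) = 1 / sqrt r * (1 / sqrt (2 * pi * \<tau>\<^sup>2))"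
      unfolding \<tau>(2) using r assms by (simp add: real_sqrt_mult real_sqrt_divide)
    ultimately show ?thesis
      by (simp add: normal_density_def mult.assoc flip: exp_add)
  qed
  have "(\<integral>\<^sup>+z. ennreal (exp (s * z\<^sup>2)) \<partial>density lborel (normal_density 0 \<sigma>)) =
      (\<integral>\<^sup>+z. ennreal (1 / sqrt r) * ennreal (normal_density 0 \<tau> z) \<partial>lborel)"
  proof (subst nn_integral_density)
    show "(\<integral>\<^sup>+z. ennreal (normal_density 0 \<sigma> z) * ennreal (exp (s * z\<^sup>2)) \<partial>lborel) =
        (\<integral>\<^sup>+z. ennreal (1 / sqrt r) * ennreal (normal_density 0 \<tau> z) \<partial>lborel)"
      using r by (intro nn_integral_cong) (simp add: eq flip: ennreal_mult)
  qed auto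
  also have "\<dots> = ennreal (1 / sqrt r)"
    using \<tau>(1) by (simp add: nn_integral_cmult integral_normal_density integrable_normal_density nn_integral_eq_integral)
  finally show ?thesis by (simp add: r_def)
qed

text \<open>This is the moment generating function of a chi-square variable with
  \<open>card T\<close> degrees of freedom: the integral factorises over the product measure, and
  coordinates outside \<open>T\<close> contribute 1.\<close>

lemma nn_integral_exp_sum_squares_noise:
  fixes s :: real
  assumes "n > 0" "T \<subseteq> {..<n}" "s < 1 / 2"
  shows "(\<integral>\<^sup>+z. ennreal (exp (s * (real n * (\<Sum>i\<in>T. (z i)\<^sup>2)))) \<partial>noise n) =
    ennreal ((1 / sqrt (1 - 2 * s)) ^ card T)"
proof -
  let ?N = "density lborel (normal_density 0 (1 / sqrt (real n)))"
  let ?f = "\<lambda>i z. if i \<in> T then ennreal (exp (s * real n * z\<^sup>2)) else 1"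
  interpret N: prob_space ?N using assms by (intro prob_space_normal_density) simp
  interpret product_sigma_finite "\<lambda>_. ?N" by standard
  have fin: "finite T" using assms(2) finite_subset by blast
  have "(\<integral>\<^sup>+z. ennreal (exp (s * (real n * (\<Sum>i\<in>T. (z i)\<^sup>2)))) \<partial>noise n) =
      (\<integral>\<^sup>+z. (\<Prod>i<n. ?f i (z i)) \<partial>noise n)"
  proof (rule nn_integral_cong)
    fix z :: "nat \<Rightarrow> real"
    have "(\<Prod>i<n. ?f i (z i)) = (\<Prod>i\<in>T. ennreal (exp (s * real n * (z i)\<^sup>2)))"
      using assms(2) by (subst prod.If_cases) (auto simp: Int_absorb1)
    also have "\<dots> = ennreal (exp (s * (real n * (\<Sum>i\<in>T. (z i)\<^sup>2))))"
      using fin by (simp add: prod_ennreal exp_sum sum_distrib_left mult.assoc)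
    finally show "ennreal (exp (s * (real n * (\<Sum>i\<in>T. (z i)\<^sup>2)))) = (\<Prod>i<n. ?f i (z i))" ..
  qed
  also have "\<dots> = (\<Prod>i<n. \<integral>\<^sup>+z. ?f i z \<partial>?N)"
    unfolding noise_def by (rule product_nn_integral_prod) auto
  also have "\<dots> = (\<Prod>i<n. if i \<in> T then ennreal (1 / sqrt (1 - 2 * s)) else 1)"
  proof (rule prod.cong[OF refl])
    fix i
    have "2 * (s * real n) * (1 / sqrt (real n))\<^sup>2 = 2 * s"
      using assms(1) by (simp add: power_divide)
    note eq = this
    have "(\<integral>\<^sup>+z. ennreal (exp (s * real n * z\<^sup>2)) \<partial>?N) = ennreal (1 / sqrt (1 - 2 * s))"
      using assms nn_integral_exp_square_normal[of "1 / sqrt (real n)" "s * real n"]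
      unfolding eq by simp
    then show "(\<integral>\<^sup>+z. ?f i z \<partial>?N) = (if i \<in> T then ennreal (1 / sqrt (1 - 2 * s)) else 1)"
      using N.emeasure_space_1 by (cases "i \<in> T") (simp_all del: space_density)
  qed
  also have "\<dots> = ennreal ((1 / sqrt (1 - 2 * s)) ^ card T)"
    using assms(2,3) by (subst prod.If_cases) (auto simp: Int_absorb1 ennreal_power)
  finally show ?thesis .
qed

lemma measurable_noise_component [measurable]:
  "i < n \<Longrightarrow> (\<lambda>z. z i) \<in> borel_measurable (noise n)"
  using measurable_component_singleton[of i "{..<n}" "\<lambda>_. borel"]
  by (simp add: measurable_cong_sets[OF sets_noise refl])

lemma borel_measurable_sum_squares_noise [measurable]:
  assumes "T \<subseteq> {..<n}"
  shows "(\<lambda>z. \<Sum>i\<in>T. (z i)\<^sup>2) \<in> borel_measurable (noise n)"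
  using assms by (intro borel_measurable_sum borel_measurable_power measurable_noise_component) auto

text \<open>Leaving the sign of \<open>s\<close> free lets one Markov inequality serve both tails: s
  = 1/4 for the upper one, s = -1/2 for the lower one.\<close>

lemma noise_exponential_Markov:
  fixes s a :: real
  assumes "n > 0" "T \<subseteq> {..<n}" "s < 1 / 2"
  shows "measure (noise n) {z\<in>space (noise n). s * a \<le> s * (real n * (\<Sum>i\<in>T. (z i)\<^sup>2))} \<le>
    exp (- s * a) * (1 / sqrt (1 - 2 * s)) ^ card T"
proof -
  interpret prob_space "noise n" using assms(1) by (rule prob_space_noise)
  let ?u = "\<lambda>z. ennreal (exp (s * (real n * (\<Sum>i\<in>T. (z i)\<^sup>2))))"
  note [measurable] = borel_measurable_sum_squares_noise[OF assms(2)]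
  have "emeasure (noise n) {z\<in>space (noise n). s * a \<le> s * (real n * (\<Sum>i\<in>T. (z i)\<^sup>2))} \<le>
     emeasure (noise n) ({z\<in>space (noise n). 1 \<le> ennreal (exp (- s * a)) * ?u z})"
    by (intro emeasure_mono) (auto simp flip: ennreal_mult' exp_add)
  also have "\<dots> \<le> ennreal (exp (- s * a)) * (\<integral>\<^sup>+z. ?u z \<partial>noise n)"
    using nn_integral_Markov_inequality[of ?u "space (noise n)" "noise n" "ennreal (exp (- s * a))"]
    by (simp cong: nn_integral_cong_simp)
  also have "\<dots> = ennreal (exp (- s * a) * (1 / sqrt (1 - 2 * s)) ^ card T)"
    unfolding nn_integral_exp_sum_squares_noise[OF assms] by (simp flip: ennreal_mult')
  finally show ?thesis
    using assms(3) by (simp add: emeasure_eq_measure)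
qed

lemma noise_sum_squares_upper_tail:
  fixes a :: real
  assumes "n > 0" "T \<subseteq> {..<n}"
  shows "measure (noise n) {z\<in>space (noise n). a \<le> real n * (\<Sum>i\<in>T. (z i)\<^sup>2)} \<le>
    exp (real (card T) / 2 - a / 4)"
proof -
  \<comment> \<open>With s = 1/4 each coordinate contributes 1 / sqrt (1/2) = sqrt 2.\<close>
  have "sqrt 2 \<le> exp (1 / 2 :: real)"
    using exp_ge_add_one_self[of "1 :: real"] 
    by (intro real_le_lsqrt) (auto simp flip: exp_double)
  then have "sqrt 2 ^ card T \<le> exp (1 / 2 :: real) ^ card T"
    by (intro power_mono) auto
  also have "\<dots> = exp (real (card T) / 2)"
    by (simp flip: exp_of_nat_mult)
  finally have "exp (- a / 4) * sqrt 2 ^ card T \<le> exp (- a / 4) * exp (real (card T) / 2)"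
    by simp
  also have "\<dots> = exp (real (card T) / 2 - a / 4)"
    by (simp flip: exp_add)
  finally have "exp (- a / 4) * sqrt 2 ^ card T \<le> exp (real (card T) / 2 - a / 4)" .
  then show ?thesis
    using noise_exponential_Markov[OF assms, of "1 / 4" a]
    by (simp add: real_sqrt_divide)
qed

lemma noise_sum_squares_lower_tail:
  assumes "n > 0" "T \<subseteq> {..<n}"
  shows "measure (noise n)
    {z\<in>space (noise n). real n * (\<Sum>i\<in>T. (z i)\<^sup>2) \<le> real (card T) / 2} \<le> exp (- real (card T) / 12)"
proof -
  \<comment> \<open>With s = -1/2 each coordinate contributes 1 / sqrt 2 <= exp (-1/3), and the
    threshold costs exp (1/4) per coordinate; 1/4 - 1/3 = -1/12.\<close>
  have "1 / sqrt 2 = exp (- ln 2 / 2 :: real)"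
    by (simp add: exp_minus ln_sqrt[symmetric] inverse_eq_divide)
  also have "\<dots> \<le> exp (- (1 / 3))"
    using ln2_ge_two_thirds by simp
  finally have "(1 / sqrt 2) ^ card T \<le> exp (- (1 / 3) :: real) ^ card T"
    by (intro power_mono) auto
  also have "\<dots> = exp (- real (card T) / 3)"
    by (simp flip: exp_of_nat_mult)
  finally have "exp (real (card T) / 4) * (1 / sqrt 2) ^ card T \<le>
      exp (real (card T) / 4) * exp (- real (card T) / 3)"
    by simp
  also have "\<dots> = exp (- real (card T) / 12)"
    by (simp flip: exp_add)
  finally show ?thesis
    using noise_exponential_Markov[OF assms, of "- 1 / 2" "real (card T) / 2"]
    by (simp add: mult.commute)
qed

subsection \<open>Random sign matrices\<close>

text \<open>The random matrix is handled by counting: expectations over independent signs become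
  unnormalised sums over this finite set, whence the factors \<open>2 ^ n\<close> below.\<close>

definition sign_vectors :: "nat \<Rightarrow> (nat \<Rightarrow> real) set" where
  "sign_vectors n = Pi\<^sub>E {..<n} (\<lambda>_. {- 1, 1})"

lemma finite_sign_vectors [simp]: "finite (sign_vectors n)"
  unfolding sign_vectors_def by (intro finite_PiE) auto

lemma card_sign_vectors [simp]: "card (sign_vectors n) = 2 ^ n"
  by (simp add: sign_vectors_def card_PiE numeral_2_eq_2)

lemma sum_prod_sign_vectors:
  fixes f :: "nat \<Rightarrow> real \<Rightarrow> real"
  shows "(\<Sum>a\<in>sign_vectors n. \<Prod>i<n. f i (a i)) = (\<Prod>i<n. f i (- 1) + f i 1)"
  unfolding sign_vectors_def by (subst prod_sum_PiE[symmetric]) auto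

lemma sum_sign_vectors_mult:
  assumes "i < n" "j < n"
  shows "(\<Sum>a\<in>sign_vectors n. a i * a j) = (if i = j then 2 ^ n else 0)"
proof -
  \<comment> \<open>The product of two coordinates becomes a product over all coordinates, so the
    sum factorises; for distinct \<open>i\<close> and \<open>j\<close> the factor at
    \<open>i\<close> is -1 + 1 = 0.\<close>
  let ?f = "\<lambda>l (s::real). (if l = i then s else 1) * (if l = j then s else 1)"
  have "(\<Sum>a\<in>sign_vectors n. a i * a j) = (\<Sum>a\<in>sign_vectors n. \<Prod>l<n. ?f l (a l))"
    using assms by (simp add: prod.distrib prod.delta)
  also have "\<dots> = (\<Prod>l<n. ?f l (- 1) + ?f l 1)"
    by (rule sum_prod_sign_vectors)
  also have "\<dots> = (if i = j then 2 ^ n else 0)"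
  proof (cases "i = j")
    case True
    then have "(\<Prod>l<n. ?f l (- 1) + ?f l 1) = (\<Prod>l<n. 2)"
      by (intro prod.cong) auto
    with True show ?thesis by simp
  next
    case False
    then show ?thesis using assms by (auto intro!: prod_zero bexI[of _ i])
  qed
  finally show ?thesis .
qed

text \<open>Random sign vectors are isotropic: only the diagonal of the expanded double sum
  survives. Thus the mean of a product of two Rademacher forms is the inner product of their
  coefficient vectors.\<close>

lemma sum_sign_vectors_product:
  "(\<Sum>a\<in>sign_vectors n. (\<Sum>i<n. a i * p i) * (\<Sum>i<n. a i * q i)) = 2 ^ n * (\<Sum>i<n. p i * q i)"
proof -
  have "(\<Sum>a\<in>sign_vectors n. (\<Sum>i<n. a i * p i) * (\<Sum>i<n. a i * q i)) =
      (\<Sum>a\<in>sign_vectors n. \<Sum>i<n. \<Sum>j<n. p i * q j * (a i * a j))"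
    by (simp add: sum_product mult_ac)
  also have "\<dots> = (\<Sum>i<n. \<Sum>j<n. p i * q j * (\<Sum>a\<in>sign_vectors n. a i * a j))"
    by (subst sum.swap, intro sum.cong refl, subst sum.swap) (simp add: sum_distrib_left)
  also have "\<dots> = (\<Sum>i<n. \<Sum>j<n. if i = j then 2 ^ n * (p i * q j) else 0)"
    by (intro sum.cong refl) (auto simp: sum_sign_vectors_mult)
  also have "\<dots> = 2 ^ n * (\<Sum>i<n. p i * q i)"
    by (simp add: sum.delta' sum_distrib_left)
  finally show ?thesis .
qed

text \<open>Taylor expansion with Lagrange remainder. The factor \<open>exp \<bar>u\<bar>\<close>
  admits \<open>u\<close> of any size; for u = - t g h it is absorbed later by exponential moments
  of g^2 and h^2.\<close>

lemma exp_le_quadratic: "exp u \<le> 1 + u + u\<^sup>2 * exp \<bar>u\<bar>" for u :: real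
proof -
  obtain t where t: "\<bar>t\<bar> \<le> \<bar>u\<bar>" "exp u = (\<Sum>m<2. u ^ m / fact m) + exp t / fact 2 * u ^ 2"
    using Maclaurin_exp_le[of u 2] by auto
  have "exp t / 2 \<le> exp \<bar>u\<bar>"
    using t(1) by (smt (verit) exp_le_cancel_iff exp_gt_zero field_sum_of_halves)
  then have "exp t / 2 * u\<^sup>2 \<le> exp \<bar>u\<bar> * u\<^sup>2" by (intro mult_right_mono) auto
  then show ?thesis using t(2) by (simp add: eval_nat_numeral mult_ac)
qed

text \<open>For u >= 0 the derivative of u^2 / 2 - ln (cosh u) is u - tanh u, which is nonnegative
  because sinh v <= v cosh v. Evenness covers u < 0.\<close>

lemma cosh_le_exp_half_square: "cosh u \<le> exp (u\<^sup>2 / 2)" for u :: real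
proof -
  have pos: "cosh u \<le> exp (u\<^sup>2 / 2)" if "u \<ge> 0" for u :: real
  proof -
    have sinh: "sinh v \<le> v * cosh v" if "v \<ge> 0" for v :: real
    proof -
      have "0 * cosh 0 - sinh 0 \<le> v * cosh v - sinh v"
        by (rule DERIV_nonneg_imp_nondecreasing[OF that])
           (auto intro!: derivative_eq_intros exI mult_nonneg_nonneg)
      then show ?thesis by simp
    qed
    have "0\<^sup>2 / 2 - ln (cosh 0) \<le> u\<^sup>2 / 2 - ln (cosh u)"
    proof (rule DERIV_nonneg_imp_nondecreasing[OF that])
      fix v :: real assume "0 \<le> v" "v \<le> u"
      moreover have "((\<lambda>v. v\<^sup>2 / 2 - ln (cosh v)) has_real_derivative (v - sinh v / cosh v)) (at v)"
        by (auto intro!: derivative_eq_intros simp: cosh_real_pos)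
      ultimately show "\<exists>y. ((\<lambda>v. v\<^sup>2 / 2 - ln (cosh v)) has_real_derivative y) (at v) \<and> 0 \<le> y"
        using sinh[of v] cosh_real_pos[of v] by (intro exI) (auto simp: field_simps)
    qed
    then have "ln (cosh u) \<le> u\<^sup>2 / 2" by simp
    then have "exp (ln (cosh u)) \<le> exp (u\<^sup>2 / 2)" by (simp only: exp_le_cancel_iff)
    then show ?thesis by (simp only: exp_ln cosh_real_pos)
  qed
  show ?thesis using pos[of u] pos[of "- u"] by (cases "u \<ge> 0") auto
qed

text \<open>Rademacher sums are sub-Gaussian: by independence the sum splits into factors 2 cosh (b
  p_i).\<close>

lemma sum_exp_sign_vectors_le:
  fixes p :: "nat \<Rightarrow> real"
  shows "(\<Sum>a\<in>sign_vectors n. exp (b * (\<Sum>i<n. a i * p i))) \<le>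
    2 ^ n * exp (b\<^sup>2 * (\<Sum>i<n. (p i)\<^sup>2) / 2)"
proof -
  have "(\<Sum>a\<in>sign_vectors n. exp (b * (\<Sum>i<n. a i * p i))) =
      (\<Sum>a\<in>sign_vectors n. \<Prod>i<n. exp (b * (a i * p i)))"
    by (simp add: sum_distrib_left exp_sum)
  also have "\<dots> = (\<Prod>i<n. exp (b * (- 1 * p i)) + exp (b * (1 * p i)))"
    by (rule sum_prod_sign_vectors)
  also have "\<dots> \<le> (\<Prod>i<n. 2 * exp (b\<^sup>2 * (p i)\<^sup>2 / 2))"
  proof (intro prod_mono conjI)
    fix i
    show "exp (b * (- 1 * p i)) + exp (b * (1 * p i)) \<le> 2 * exp (b\<^sup>2 * (p i)\<^sup>2 / 2)"
      using cosh_le_exp_half_square[of "b * p i"] by (simp add: cosh_def power_mult_distrib)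
  qed (simp add: add_nonneg_nonneg)
  also have "\<dots> = 2 ^ n * exp (b\<^sup>2 * (\<Sum>i<n. (p i)\<^sup>2) / 2)"
    by (simp add: prod.distrib exp_sum sum_distrib_left sum_divide_distrib)
  finally show ?thesis .
qed

text \<open>Completing the square turns the tilted density into a Gaussian density with mean
  \<open>b\<close>.\<close>

lemma nn_integral_exp_linear_normal:
  "(\<integral>\<^sup>+\<xi>. ennreal (exp (b * \<xi>)) \<partial>density lborel (normal_density 0 1)) = ennreal (exp (b\<^sup>2 / 2))"
proof -
  have eq: "normal_density 0 1 \<xi> * exp (b * \<xi>) = exp (b\<^sup>2 / 2) * normal_density b 1 \<xi>" for \<xi>
  proof -
    have "- \<xi>\<^sup>2 / 2 + b * \<xi> = b\<^sup>2 / 2 - (\<xi> - b)\<^sup>2 / 2"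
      by (simp add: power2_eq_square field_simps)
    then have "exp (- \<xi>\<^sup>2 / 2) * exp (b * \<xi>) = exp (b\<^sup>2 / 2) * exp (- (\<xi> - b)\<^sup>2 / 2)"
      by (simp flip: exp_add)
    then show ?thesis by (simp add: normal_density_def)
  qed
  have "(\<integral>\<^sup>+\<xi>. ennreal (exp (b * \<xi>)) \<partial>density lborel (normal_density 0 1)) =
      (\<integral>\<^sup>+\<xi>. ennreal (exp (b\<^sup>2 / 2)) * ennreal (normal_density b 1 \<xi>) \<partial>lborel)"
  proof (subst nn_integral_density)
    show "(\<integral>\<^sup>+\<xi>. ennreal (normal_density 0 1 \<xi>) * ennreal (exp (b * \<xi>)) \<partial>lborel) =
        (\<integral>\<^sup>+\<xi>. ennreal (exp (b\<^sup>2 / 2)) * ennreal (normal_density b 1 \<xi>) \<partial>lborel)"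
      by (intro nn_integral_cong) (simp add: eq flip: ennreal_mult)
  qed auto
  also have "\<dots> = ennreal (exp (b\<^sup>2 / 2))"
    by (simp add: nn_integral_cmult integral_normal_density integrable_normal_density nn_integral_eq_integral)
  finally show ?thesis .
qed

text \<open>The square is linearised by \<open>exp (g\<^sup>2 / 4) = E exp (\<xi> * g / sqrt 2)\<close> for a standard
  Gaussian \<open>\<xi>\<close>.\<close>

lemma sum_exp_square_sign_vectors_le:
  fixes p :: "nat \<Rightarrow> real"
  assumes "(\<Sum>i<n. (p i)\<^sup>2) \<le> 1"
  shows "(\<Sum>a\<in>sign_vectors n. exp ((\<Sum>i<n. a i * p i)\<^sup>2 / 4)) \<le> 2 * 2 ^ n"
proof -
  let ?N = "density lborel (normal_density 0 1)"
  let ?g = "\<lambda>a. \<Sum>i<n. a i * p i"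
  have "ennreal (\<Sum>a\<in>sign_vectors n. exp ((?g a)\<^sup>2 / 4)) =
      (\<Sum>a\<in>sign_vectors n. \<integral>\<^sup>+\<xi>. ennreal (exp (?g a / sqrt 2 * \<xi>)) \<partial>?N)"
    unfolding nn_integral_exp_linear_normal by (simp add: power_divide)
  also have "\<dots> = (\<integral>\<^sup>+\<xi>. (\<Sum>a\<in>sign_vectors n. ennreal (exp (?g a / sqrt 2 * \<xi>))) \<partial>?N)"
    by (intro nn_integral_sum[symmetric]) auto
  \<comment> \<open>For fixed \<xi> the inner sum is a sub-Gaussian moment with b = \<xi> / sqrt 2.
    What remains, exp (\<xi>^2 / 4), has Gaussian mean sqrt 2.\<close>
  also have "\<dots> \<le> (\<integral>\<^sup>+\<xi>. ennreal (2 ^ n) * ennreal (exp (1 / 4 * \<xi>\<^sup>2)) \<partial>?N)"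
  proof (intro nn_integral_mono)
    fix \<xi> :: real
    have "(\<Sum>a\<in>sign_vectors n. exp (?g a / sqrt 2 * \<xi>)) =
        (\<Sum>a\<in>sign_vectors n. exp (\<xi> / sqrt 2 * ?g a))"
      by (simp add: mult.commute)
    also have "\<dots> \<le> 2 ^ n * exp ((\<xi> / sqrt 2)\<^sup>2 * (\<Sum>i<n. (p i)\<^sup>2) / 2)"
      by (rule sum_exp_sign_vectors_le)
    also have "\<dots> \<le> 2 ^ n * exp (1 / 4 * \<xi>\<^sup>2)"
      using mult_left_mono[OF assms, of "\<xi>\<^sup>2"] by (simp add: power_divide)
    finally show "(\<Sum>a\<in>sign_vectors n. ennreal (exp (?g a / sqrt 2 * \<xi>))) \<le>
        ennreal (2 ^ n) * ennreal (exp (1 / 4 * \<xi>\<^sup>2))"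
      by (simp flip: ennreal_mult)
  qed
  also have "\<dots> = ennreal (2 ^ n) * ennreal (sqrt 2)"
    using nn_integral_exp_square_normal[of 1 "1 / 4"]
    by (subst nn_integral_cmult) (auto simp: real_sqrt_divide)
  also have "\<dots> = ennreal (2 ^ n * sqrt 2)" by (simp flip: ennreal_mult)
  finally have "(\<Sum>a\<in>sign_vectors n. exp ((?g a)\<^sup>2 / 4)) \<le> 2 ^ n * sqrt 2"
    by (simp add: ennreal_le_iff)
  also have "\<dots> \<le> 2 ^ n * 2"
    by (intro mult_left_mono real_le_lsqrt) auto
  finally show ?thesis by (simp add: mult.commute)
qed

text \<open>Second-order expansion of a moment generating function: the linear term is given by
  isotropy, and the remainder is bounded by the two averages of exponentials of squares, each at
  most 2; 64 * (2 + 2) = 256.\<close>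

lemma sum_exp_neg_product_sign_vectors_le:
  fixes p q :: "nat \<Rightarrow> real"
  assumes p: "(\<Sum>i<n. (p i)\<^sup>2) \<le> 1" and q: "(\<Sum>i<n. (q i)\<^sup>2) \<le> 1" and t: "0 \<le> t" "t \<le> 1 / 8"
  shows "(\<Sum>a\<in>sign_vectors n. exp (- t * ((\<Sum>i<n. a i * p i) * (\<Sum>i<n. a i * q i)))) \<le>
    2 ^ n * (1 - t * (\<Sum>i<n. p i * q i) + 256 * t\<^sup>2)"
proof -
  let ?g = "\<lambda>a. \<Sum>i<n. a i * p i" and ?h = "\<lambda>a. \<Sum>i<n. a i * q i"
  have pointwise: "exp (- t * (g * h)) \<le>
      1 - t * (g * h) + 64 * t\<^sup>2 * (exp (g\<^sup>2 / 4) + exp (h\<^sup>2 / 4))" for g h :: real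
  proof -
    \<comment> \<open>The exponents are matched: t <= 1/8 gives t |g h| <= s/8, bounding s^2 costs
      another s/8, and s/4 is the average of g^2/4 and h^2/4, to which convexity of exp
      applies.\<close>
    define s where "s = (g\<^sup>2 + h\<^sup>2) / 2"
    have s: "\<bar>g * h\<bar> \<le> s" "0 \<le> s"
      using sum_squares_bound[of "\<bar>g\<bar>" "\<bar>h\<bar>"] by (auto simp: s_def abs_mult)
    have "(s / 8)\<^sup>2 / 2 \<le> exp (s / 8)"
      using exp_lower_Taylor_quadratic[of "s / 8"] s(2) by simp
    then have s2: "s\<^sup>2 \<le> 128 * exp (s / 8)" by (simp add: power_divide)
    have e: "exp (t * \<bar>g * h\<bar>) \<le> exp (s / 8)"
      using mult_mono[OF t(2) s(1)] t s by simp
    have avg: "exp ((a + b) / 2) \<le> (exp a + exp b) / 2" for a b :: real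
      using sum_squares_bound[of "exp (a / 2)" "exp (b / 2)"]
      by (simp add: add_divide_distrib exp_add flip: exp_double)
    have "(t * (g * h))\<^sup>2 * exp (t * \<bar>g * h\<bar>) \<le> (t\<^sup>2 * s\<^sup>2) * exp (s / 8)"
      using s(1) e power_mono[OF s(1), of 2]
      by (intro mult_mono) (auto simp: power_mult_distrib intro!: mult_left_mono)
    also have "\<dots> \<le> (t\<^sup>2 * (128 * exp (s / 8))) * exp (s / 8)"
      using s2 by (intro mult_right_mono mult_left_mono) auto
    also have "\<dots> = 128 * t\<^sup>2 * exp ((g\<^sup>2 / 4 + h\<^sup>2 / 4) / 2)"
      by (simp add: s_def mult_exp_exp add_divide_distrib)
    also have "\<dots> \<le> 128 * t\<^sup>2 * ((exp (g\<^sup>2 / 4) + exp (h\<^sup>2 / 4)) / 2)"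
      by (intro mult_left_mono avg) auto
    finally have "(t * (g * h))\<^sup>2 * exp (t * \<bar>g * h\<bar>) \<le> 64 * t\<^sup>2 * (exp (g\<^sup>2 / 4) + exp (h\<^sup>2 / 4))"
      by simp
    moreover have "\<bar>- t * (g * h)\<bar> = t * \<bar>g * h\<bar>" using t by (simp add: abs_mult)
    ultimately show ?thesis
      using exp_le_quadratic[of "- t * (g * h)"] by simp
  qed
  have "(\<Sum>a\<in>sign_vectors n. exp (- t * (?g a * ?h a))) \<le>
      (\<Sum>a\<in>sign_vectors n. 1 - t * (?g a * ?h a) +
        64 * t\<^sup>2 * (exp ((?g a)\<^sup>2 / 4) + exp ((?h a)\<^sup>2 / 4)))"
    by (intro sum_mono pointwise)
  also have "\<dots> = 2 ^ n - t * (\<Sum>a\<in>sign_vectors n. ?g a * ?h a) +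
      64 * t\<^sup>2 * ((\<Sum>a\<in>sign_vectors n. exp ((?g a)\<^sup>2 / 4)) + (\<Sum>a\<in>sign_vectors n. exp ((?h a)\<^sup>2 / 4)))"
    by (simp add: sum.distrib sum_subtractf flip: sum_distrib_left)
  also have "\<dots> \<le> 2 ^ n - t * (2 ^ n * (\<Sum>i<n. p i * q i)) + 64 * t\<^sup>2 * (2 * 2 ^ n + 2 * 2 ^ n)"
    unfolding sum_sign_vectors_product
    by (intro add_left_mono mult_left_mono add_mono sum_exp_square_sign_vectors_le p q) auto
  also have "\<dots> = 2 ^ n * (1 - t * (\<Sum>i<n. p i * q i) + 256 * t\<^sup>2)"
    by (simp add: algebra_simps)
  finally show ?thesis .
qed

section \<open>Chernoff bound for sign matrices\<close>

definition sign_matrices :: "nat \<Rightarrow> nat \<Rightarrow> (nat \<Rightarrow> nat \<Rightarrow> real) set" where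
  "sign_matrices m n = Pi\<^sub>E {..<m} (\<lambda>_. sign_vectors n)"

lemma finite_sign_matrices [simp]: "finite (sign_matrices m n)"
  unfolding sign_matrices_def by (intro finite_PiE) auto

lemma card_sign_matrices: "card (sign_matrices m n) = (2 ^ n) ^ m"
  by (simp add: sign_matrices_def card_PiE)

text \<open>Chernoff bound in counting form: every counted matrix has weight exp (- t X) >= 1, and
  the total weight of all matrices is an \<open>m\<close>-th power because the rows vary
  independently.\<close>

lemma card_sign_matrices_nonpos_unit:
  fixes p q :: "nat \<Rightarrow> real"
  assumes p: "(\<Sum>i<n. (p i)\<^sup>2) \<le> 1" and q: "(\<Sum>i<n. (q i)\<^sup>2) \<le> 1"
    and pos: "0 \<le> (\<Sum>i<n. p i * q i)"
  shows "real (card {A\<in>sign_matrices m n. (\<Sum>r<m. (\<Sum>i<n. A r i * p i) * (\<Sum>i<n. A r i * q i)) \<le> 0}) \<le>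
    exp (- real m * (\<Sum>i<n. p i * q i)\<^sup>2 / 1024) * real (card (sign_matrices m n))"
proof -
  define \<rho> where "\<rho> = (\<Sum>i<n. p i * q i)"
  \<comment> \<open>This value minimises - t \<rho> + 256 t^2, giving - \<rho>^2 / 1024; \<rho> <= 1
    keeps it below 1/8.\<close>
  define t where "t = \<rho> / 512"
  let ?X = "\<lambda>a. (\<Sum>i<n. a i * p i) * (\<Sum>i<n. a i * q i)"
  let ?B = "{A\<in>sign_matrices m n. (\<Sum>r<m. ?X (A r)) \<le> 0}"
  have "2 * \<rho> \<le> (\<Sum>i<n. (p i)\<^sup>2 + (q i)\<^sup>2)"
    unfolding \<rho>_def sum_distrib_left
    by (intro sum_mono) (use sum_squares_bound in \<open>simp add: mult.assoc\<close>)
  then have "\<rho> \<le> 1" using p q by (simp add: sum.distrib)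
  then have t: "0 \<le> t" "t \<le> 1 / 8" using pos by (auto simp: t_def \<rho>_def)
  have "real (card ?B) = (\<Sum>A\<in>?B. 1)" by simp
  also have "\<dots> \<le> (\<Sum>A\<in>?B. exp (- t * (\<Sum>r<m. ?X (A r))))"
    using t(1) by (intro sum_mono) (auto simp: mult_nonneg_nonpos)
  also have "\<dots> \<le> (\<Sum>A\<in>sign_matrices m n. exp (- t * (\<Sum>r<m. ?X (A r))))"
    by (intro sum_mono2) auto
  also have "\<dots> = (\<Sum>A\<in>sign_matrices m n. \<Prod>r<m. exp (- t * ?X (A r)))"
    unfolding sum_distrib_left exp_sum[OF finite_lessThan] ..
  also have "\<dots> = (\<Prod>r<m. \<Sum>a\<in>sign_vectors n. exp (- t * ?X a))"
    unfolding sign_matrices_def by (rule prod_sum_PiE[symmetric]) auto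
  also have "\<dots> = (\<Sum>a\<in>sign_vectors n. exp (- t * ?X a)) ^ m"
    by simp
  also have "\<dots> \<le> (2 ^ n * exp (- \<rho>\<^sup>2 / 1024)) ^ m"
  proof (intro power_mono sum_nonneg)
    have "(\<Sum>a\<in>sign_vectors n. exp (- t * ?X a)) \<le> 2 ^ n * (1 - t * \<rho> + 256 * t\<^sup>2)"
      unfolding \<rho>_def by (intro sum_exp_neg_product_sign_vectors_le p q t)
    also have "1 - t * \<rho> + 256 * t\<^sup>2 = 1 + (- \<rho>\<^sup>2 / 1024)"
      by (simp add: t_def power2_eq_square)
    also have "2 ^ n * (1 + (- \<rho>\<^sup>2 / 1024)) \<le> 2 ^ n * exp (- \<rho>\<^sup>2 / 1024)"
      by (intro mult_left_mono exp_ge_add_one_self) auto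
    finally show "(\<Sum>a\<in>sign_vectors n. exp (- t * ?X a)) \<le> 2 ^ n * exp (- \<rho>\<^sup>2 / 1024)" .
  qed auto
  also have "\<dots> = exp (- real m * \<rho>\<^sup>2 / 1024) * real (card (sign_matrices m n))"
    by (simp add: card_sign_matrices power_mult_distrib mult.commute flip: exp_of_nat_mult)
  finally show ?thesis by (simp add: \<rho>_def)
qed

text \<open>Dividing \<open>p\<close> by \<open>sqrt P\<close> and \<open>q\<close> by
  \<open>sqrt Q\<close> reduces this to the unit case, since positive scaling preserves the sign of
  the sum. \<open>P\<close> and \<open>Q\<close> are mere upper bounds, so the norm of the signal
  need not be known exactly.\<close>

lemma card_sign_matrices_nonpos:
  fixes p q :: "nat \<Rightarrow> real"
  assumes pos: "0 < (\<Sum>i<n. p i * q i)"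
    and P: "(\<Sum>i<n. (p i)\<^sup>2) \<le> P" "0 < P" and Q: "(\<Sum>i<n. (q i)\<^sup>2) \<le> Q" "0 < Q"
  shows "real (card {A\<in>sign_matrices m n. (\<Sum>r<m. (\<Sum>i<n. A r i * p i) * (\<Sum>i<n. A r i * q i)) \<le> 0}) \<le>
    exp (- real m * ((\<Sum>i<n. p i * q i)\<^sup>2 / (P * Q)) / 1024) * real (card (sign_matrices m n))"
proof -
  define p' q' where "p' i = p i / sqrt P" and "q' i = q i / sqrt Q" for i
  have scale: "(\<Sum>i<n. a i * p' i) * (\<Sum>i<n. b i * q' i) =
      (\<Sum>i<n. a i * p i) * (\<Sum>i<n. b i * q i) / sqrt (P * Q)" for a b
    by (simp add: p'_def q'_def real_sqrt_mult flip: sum_divide_distrib)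
  have "(\<Sum>r<m. (\<Sum>i<n. A r i * p' i) * (\<Sum>i<n. A r i * q' i)) \<le> 0 \<longleftrightarrow>
      (\<Sum>r<m. (\<Sum>i<n. A r i * p i) * (\<Sum>i<n. A r i * q i)) \<le> 0" for A
    unfolding scale using P Q by (simp add: divide_le_0_iff mult_le_0_iff flip: sum_divide_distrib)
  moreover have "(\<Sum>i<n. p' i * q' i) = (\<Sum>i<n. p i * q i) / sqrt (P * Q)"
    by (simp add: p'_def q'_def real_sqrt_mult sum_divide_distrib)
  moreover have "(\<Sum>i<n. (p' i)\<^sup>2) \<le> 1" "(\<Sum>i<n. (q' i)\<^sup>2) \<le> 1"
    using P Q by (simp_all add: p'_def q'_def power_divide flip: sum_divide_distrib)
  ultimately show ?thesis
    using card_sign_matrices_nonpos_unit[of p' n q' m] P Q pos by (simp add: power_divide)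
qed

subsection \<open>The model and its derandomized schemes\<close>

text \<open>The chain is n choose k <= n^k / k! <= (e n / k)^k, the second step because k^k / k! is
  one term of the series of exp k.\<close>

lemma binomial_le_exp:
  assumes "1 \<le> k" "k \<le> n"
  shows "real (n choose k) \<le> exp (real k * (1 + ln (real n / real k)))"
proof -
  have "real k ^ k / fact k \<le> exp (real k)"
  proof -
    obtain t where "exp (real k) = (\<Sum>m<Suc k. real k ^ m / fact m) + exp t / fact (Suc k) * real k ^ Suc k"
      using Maclaurin_exp_le[of "real k" "Suc k"] by auto
    moreover have "0 \<le> (\<Sum>m<k. real k ^ m / fact m)" by (intro sum_nonneg) auto
    moreover have "0 \<le> exp t / fact (Suc k) * real k ^ Suc k" by simp
    ultimately show ?thesis by simp
  qed
  then have "(real n / real k) ^ k * (real k ^ k / fact k) \<le> (real n / real k) ^ k * exp (real k)"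
    by (intro mult_left_mono) auto
  moreover have "(real n / real k) ^ k * (real k ^ k / fact k) = real n ^ k / fact k"
    using assms by (simp add: power_divide)
  moreover have "real (n choose k) \<le> real n ^ k / fact k"
  proof -
    have "real ((n choose k) * fact k) \<le> real (n ^ k)"
      using binomial_fact_pow by (simp only: of_nat_le_iff)
    then show ?thesis by (simp add: pos_le_divide_eq)
  qed
  moreover have "exp (real k * (1 + ln (real n / real k))) = (real n / real k) ^ k * exp (real k)"
    using assms by (simp add: distrib_left exp_add exp_of_nat_mult)
  ultimately show ?thesis by simp
qed

lemma set_pmf_sparse_part:
  assumes "k \<le> n" "0 < \<epsilon>"
  shows "set_pmf (sparse_part n k \<epsilon>) =
    (\<Union>S\<in>{S. S \<subseteq> {..<n} \<and> card S = k}. PiE_dflt S 0 (\<lambda>_. {- sqrt (\<epsilon> / real k), sqrt (\<epsilon> / real k)}))"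
proof -
  have "finite {S. S \<subseteq> {..<n} \<and> card S = k}"
    by (rule finite_subset[of _ "Pow {..<n}"]) auto
  \<comment> \<open>The support of \<open>pmf_of_set\<close> is the given set only if that set is
    nonempty; here k <= n enters.\<close>
  moreover have "{..<k} \<in> {S. S \<subseteq> {..<n} \<and> card S = k}" using assms by auto
  then have "{S. S \<subseteq> {..<n} \<and> card S = k} \<noteq> {}" by blast
  ultimately show ?thesis
    by (auto simp: sparse_part_def set_Pi_pmf finite_subset set_pmf_of_set comp_def)
qed

text \<open>Every realisation of the sparse part has squared norm exactly \<epsilon>. Among vectors
  of equal norm, maximal correlation with a vector means minimal distance to it, which is why
  correlation decoding works.\<close>

lemma sparse_partE:
  assumes "y \<in> set_pmf (sparse_part n k \<epsilon>)" "1 \<le> k" "k \<le> n" "0 < \<epsilon>"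
  obtains S where "S \<subseteq> {..<n}" "card S = k" "\<And>i. i \<notin> S \<Longrightarrow> y i = 0"
    "(\<Sum>i<n. (y i)\<^sup>2) = \<epsilon>"
proof -
  from assms obtain S where S: "S \<subseteq> {..<n}" "card S = k"
    and y: "y \<in> PiE_dflt S 0 (\<lambda>_. {- sqrt (\<epsilon> / real k), sqrt (\<epsilon> / real k)})"
    by (auto simp: set_pmf_sparse_part)
  have 0: "y i = 0" if "i \<notin> S" for i using y that by (auto simp: PiE_dflt_def)
  have "(y i)\<^sup>2 = \<epsilon> / real k" if "i \<in> S" for i
  proof -
    have "y i \<in> {- sqrt (\<epsilon> / real k), sqrt (\<epsilon> / real k)}"
      using y that by (auto simp: PiE_dflt_def)
    then show ?thesis using assms by auto
  qed
  then have "(\<Sum>i\<in>S. (y i)\<^sup>2) = \<epsilon>" using S assms by simp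
  moreover have "(\<Sum>i<n. (y i)\<^sup>2) = (\<Sum>i\<in>S. (y i)\<^sup>2)"
    using S 0 by (intro sum.mono_neutral_right) auto
  ultimately show thesis using that S 0 by simp
qed

lemma finite_set_pmf_sparse_part:
  assumes "k \<le> n" "0 < \<epsilon>"
  shows "finite (set_pmf (sparse_part n k \<epsilon>))"
proof -
  have "finite {S. S \<subseteq> {..<n} \<and> card S = k}"
    by (rule finite_subset[of _ "Pow {..<n}"]) auto
  moreover have "finite (PiE_dflt S 0 (\<lambda>_. {- sqrt (\<epsilon> / real k), sqrt (\<epsilon> / real k)}))" if "S \<subseteq> {..<n}" for S
    using finite_subset[OF that] by (intro finite_PiE_dflt) auto
  ultimately show ?thesis
    unfolding set_pmf_sparse_part[OF assms] by blast
qed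

text \<open>There are n choose k supports with at most 2^k <= e^k sign patterns each. The exponent
  is the price of the union bound over candidates.\<close>

lemma card_set_pmf_sparse_part_le:
  assumes "1 \<le> k" "k \<le> n" "0 < \<epsilon>"
  shows "real (card (set_pmf (sparse_part n k \<epsilon>))) \<le>
    exp (real k * (1 + ln (real n / real k)) + real k)"
proof -
  let ?I = "{S. S \<subseteq> {..<n} \<and> card S = k}"
  let ?F = "\<lambda>S. PiE_dflt S (0::real) (\<lambda>_. {- sqrt (\<epsilon> / real k), sqrt (\<epsilon> / real k)})"
  have I: "finite ?I" by (rule finite_subset[of _ "Pow {..<n}"]) auto
  have "card (set_pmf (sparse_part n k \<epsilon>)) \<le> (\<Sum>S\<in>?I. card (?F S))"
    unfolding set_pmf_sparse_part[OF assms(2,3)] by (rule card_UN_le[OF I])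
  also have "\<dots> \<le> (\<Sum>S\<in>?I. 2 ^ k)"
  proof (rule sum_mono)
    fix S assume S: "S \<in> ?I"
    then have "finite S" by (auto intro: finite_subset)
    then have "card (?F S) = card {- sqrt (\<epsilon> / real k), sqrt (\<epsilon> / real k)} ^ card S"
      by (simp add: card_PiE_dflt)
    also have "\<dots> \<le> 2 ^ card S"
      by (intro power_mono) (simp_all add: card_insert_if)
    finally show "card (?F S) \<le> 2 ^ k" using S by simp
  qed
  also have "\<dots> = (n choose k) * 2 ^ k"
    using n_subsets[of "{..<n}" k] by simp
  finally have "real (card (set_pmf (sparse_part n k \<epsilon>))) \<le> real ((n choose k) * 2 ^ k)"
    by (simp only: of_nat_le_iff)
  then have "real (card (set_pmf (sparse_part n k \<epsilon>))) \<le> real (n choose k) * 2 ^ k"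
    by simp
  also have "\<dots> \<le> exp (real k * (1 + ln (real n / real k))) * exp 1 ^ k"
    using exp_ge_add_one_self[of 1]
    by (intro mult_mono binomial_le_exp assms power_mono) auto
  also have "\<dots> = exp (real k * (1 + ln (real n / real k)) + real k)"
    by (simp add: exp_add flip: exp_of_nat_mult)
  finally show ?thesis .
qed

section \<open>Energies and measurability of the guarantee\<close>

lemma L2_set_square_lessThan: "(L2_set f {..<n})\<^sup>2 = (\<Sum>i<n. (f i)\<^sup>2)"
  by (simp add: L2_set_def sum_nonneg)

lemma L2_set_zero_largest_square:
  "(L2_set (zero_largest n k x) {..<n})\<^sup>2 =
    (\<Sum>i<n. (x i)\<^sup>2) - (\<Sum>i\<in>largest_coords n k x. (x i)\<^sup>2)"
proof -
  have sub: "largest_coords n k x \<subseteq> {..<n}" by (auto simp: largest_coords_def)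
  have "(L2_set (zero_largest n k x) {..<n})\<^sup>2 = (\<Sum>i<n. if i \<in> largest_coords n k x then 0 else (x i)\<^sup>2)"
    unfolding L2_set_square_lessThan by (intro sum.cong) (auto simp: zero_largest_def)
  also have "\<dots> = (\<Sum>i\<in>{..<n} - largest_coords n k x. (x i)\<^sup>2)"
    by (subst sum.If_cases) (auto simp: Diff_eq)
  also have "\<dots> = (\<Sum>i<n. (x i)\<^sup>2) - (\<Sum>i\<in>largest_coords n k x. (x i)\<^sup>2)"
    using sub by (simp add: sum_diff)
  finally show ?thesis .
qed

lemma measurable_borel_vec_component:
  "i < n \<Longrightarrow> f \<in> M \<rightarrow>\<^sub>M borel_vec n \<Longrightarrow> (\<lambda>w. f w i) \<in> borel_measurable M"
  by (rule measurable_compose[OF _ measurable_component_singleton]) auto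

lemma measurable_l2_l2_guarantee:
  assumes x: "x \<in> M \<rightarrow>\<^sub>M borel_vec n" and h: "h \<in> M \<rightarrow>\<^sub>M borel_vec n"
  shows "Measurable.pred M (\<lambda>w. l2_l2_guarantee n k \<epsilon> (x w) (h w))"
proof -
  have xm: "(\<lambda>w. x w i) \<in> borel_measurable M" if "i < n" for i
    by (rule measurable_borel_vec_component[OF that x])
  have hm: "(\<lambda>w. h w i) \<in> borel_measurable M" if "i < n" for i
    by (rule measurable_borel_vec_component[OF that h])
  have largest: "Measurable.pred M (\<lambda>w. i \<in> largest_coords n k (x w))" if i: "i < n" for i
  proof -
    \<comment> \<open>The rank of \<open>i\<close> is rewritten as a finite sum of indicators, so
      membership becomes a comparison of Borel functions.\<close>
    have "i \<in> largest_coords n k (x w) \<longleftrightarrow>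
        (\<Sum>j<n. if \<bar>x w i\<bar> < \<bar>x w j\<bar> \<or> (\<bar>x w j\<bar> = \<bar>x w i\<bar> \<and> j < i) then 1 else 0 :: real) < real k" for w
      using i by (simp add: largest_coords_def sum.If_cases Int_def)
    moreover have "(\<lambda>w. \<Sum>j<n. if \<bar>x w i\<bar> < \<bar>x w j\<bar> \<or> (\<bar>x w j\<bar> = \<bar>x w i\<bar> \<and> j < i)
        then 1 else 0 :: real) \<in> borel_measurable M"
    proof (rule borel_measurable_sum)
      fix j assume "j \<in> {..<n}"
      then have [measurable]: "(\<lambda>w. x w j) \<in> borel_measurable M" "(\<lambda>w. x w i) \<in> borel_measurable M"
        using xm i by auto
      show "(\<lambda>w. if \<bar>x w i\<bar> < \<bar>x w j\<bar> \<or> (\<bar>x w j\<bar> = \<bar>x w i\<bar> \<and> j < i) then 1 else 0 :: real)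
          \<in> borel_measurable M"
        by measurable
    qed
    ultimately show ?thesis by (simp add: borel_measurable_const borel_measurable_pred_less)
  qed
  have [measurable]: "(\<lambda>w. \<Sum>i<n. (zero_largest n k (x w) i)\<^sup>2) \<in> borel_measurable M"
  proof (intro borel_measurable_sum)
    fix i assume i: "i \<in> {..<n}"
    then have [measurable]: "(\<lambda>w. x w i) \<in> borel_measurable M"
      "Measurable.pred M (\<lambda>w. i \<in> largest_coords n k (x w))"
      using xm largest by auto
    have "(\<lambda>w. (if i \<in> largest_coords n k (x w) then 0 else x w i)\<^sup>2) \<in> borel_measurable M"
      by measurable
    then show "(\<lambda>w. (zero_largest n k (x w) i)\<^sup>2) \<in> borel_measurable M"
      using i by (simp add: zero_largest_def)
  qed
  have [measurable]: "(\<lambda>w. \<Sum>i<n. (h w i - x w i)\<^sup>2) \<in> borel_measurable M"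
    using xm hm by (intro borel_measurable_sum borel_measurable_power borel_measurable_diff) auto
  show ?thesis
    unfolding l2_l2_guarantee_def L2_set_square_lessThan by measurable
qed

text \<open>A bound on the average failure probability over finitely many schemes gives one scheme
  with that failure probability, so the seed can be taken trivial.\<close>

lemma exists_member_measure_le:
  assumes "prob_space M" "finite F" "F \<noteq> {}" "\<And>A. A \<in> F \<Longrightarrow> D A \<in> sets M"
    and "\<And>w. w \<in> space M \<Longrightarrow> real (card {A\<in>F. w \<in> D A}) \<le> c * real (card F)"
  shows "\<exists>A\<in>F. measure M (D A) \<le> c"
proof (rule ccontr)
  interpret prob_space M by fact
  assume "\<not> (\<exists>A\<in>F. measure M (D A) \<le> c)"
  then have "(\<Sum>A\<in>F. c) < (\<Sum>A\<in>F. measure M (D A))"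
    using assms by (intro sum_strict_mono) auto
  \<comment> \<open>Double counting: exchanging sum and integral replaces the sum of the measures by
    the mean number of bad members, which is bounded pointwise.\<close>
  also have "\<dots> = (\<integral>w. (\<Sum>A\<in>F. indicator (D A) w) \<partial>M)"
    using assms(4) by (subst Bochner_Integration.integral_sum) (auto simp: emeasure_eq_measure)
  also have "\<dots> \<le> (\<integral>w. c * real (card F) \<partial>M)"
  proof (rule integral_mono)
    fix w assume "w \<in> space M"
    moreover have "(\<Sum>A\<in>F. indicator (D A) w :: real) = real (card {A\<in>F. w \<in> D A})"
      using assms(2) by (simp add: indicator_def sum.If_cases Int_def)
    ultimately show "(\<Sum>A\<in>F. indicator (D A) w :: real) \<le> c * real (card F)"
      using assms(5) by simp
  qed (use assms(4) in \<open>auto simp: emeasure_eq_measure\<close>)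
  also have "\<dots> = (\<Sum>A\<in>F. c)" by (simp add: prob_space)
  finally show False by simp
qed

text \<open>Separates two sources of failure: the noise leaves the event \<open>G\<close>, at cost
  \<open>\<delta>\<^sub>1\<close>, or the matrix is bad for a fixed good signal, for a fraction
  \<open>\<delta>\<^sub>2\<close> of \<open>F\<close>. Only a counting bound for each fixed signal
  then remains to be shown.\<close>

lemma exists_deterministic_scheme:
  fixes dec :: "(nat \<Rightarrow> nat \<Rightarrow> real) \<Rightarrow> (nat \<Rightarrow> real) \<Rightarrow> nat \<Rightarrow> real"
  assumes "n > 0" and F: "finite F" "F \<noteq> {}"
    and dec: "\<And>A. A \<in> F \<Longrightarrow> dec A \<in> borel_vec m \<rightarrow>\<^sub>M borel_vec n"
    and G: "Measurable.pred (noise n) G" "measure (noise n) {z\<in>space (noise n). \<not> G z} \<le> \<delta>\<^sub>1"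
    and "0 \<le> \<delta>\<^sub>2"
    and fail: "\<And>y z x. y \<in> set_pmf (sparse_part n k \<epsilon>) \<Longrightarrow> G z \<Longrightarrow> (\<And>i. i < n \<Longrightarrow> x i = y i + z i) \<Longrightarrow>
      real (card {A\<in>F. \<not> l2_l2_guarantee n k \<epsilon> x (dec A (\<lambda>i\<in>{..<m}. \<Sum>j<n. A i j * x j))})
        \<le> \<delta>\<^sub>2 * real (card F)"
  shows "\<exists>R :: (nat \<Rightarrow> real) sensing_scheme. is_sensing_scheme m n R \<and>
    \<P>((w, x) in seed R \<Otimes>\<^sub>M spiked_covariance n k \<epsilon>.
       l2_l2_guarantee n k \<epsilon> x (estimate m n R w x)) \<ge> 1 - (\<delta>\<^sub>1 + \<delta>\<^sub>2)"
proof -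
  have measure_Times: "measure (M \<Otimes>\<^sub>M N) (A \<times> B) = measure M A * measure N B"
    if "prob_space N" "A \<in> sets M" "B \<in> sets N" for M :: "(nat \<Rightarrow> real) measure" and N :: "(nat \<Rightarrow> real) measure" and A B
  proof -
    interpret prob_space N by fact
    show ?thesis using that by (simp add: measure_def emeasure_pair_measure_Times enn2real_mult)
  qed
  let ?Y = "sparse_part n k \<epsilon>"
  let ?X = "\<lambda>(y, z). \<lambda>i\<in>{..<n}. y i + z i :: real"
  let ?P = "measure_pmf ?Y \<Otimes>\<^sub>M noise n"
  let ?D = "spiked_covariance n k \<epsilon>"
  define est where "est A x = dec A (\<lambda>i\<in>{..<m}. \<Sum>j<n. A i j * x j)" for A x
  interpret Y: prob_space "measure_pmf ?Y" by (rule measure_pmf.prob_space_axioms)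
  interpret Z: prob_space "noise n" using assms(1) by (rule prob_space_noise)
  interpret YZ: pair_prob_space "measure_pmf ?Y" "noise n" ..
  interpret D: prob_space ?D using assms(1) by (rule prob_space_spiked_covariance)
  have id: "(\<lambda>x. x) \<in> borel_vec n \<rightarrow>\<^sub>M borel_vec n" by simp
  have est: "est A \<in> borel_vec n \<rightarrow>\<^sub>M borel_vec n" if "A \<in> F" for A
    unfolding est_def
    by (rule measurable_compose[OF _ dec[OF that]], rule measurable_restrict,
        intro borel_measurable_sum borel_measurable_times measurable_borel_vec_component[OF _ id]) auto
  have good: "Measurable.pred (borel_vec n) (\<lambda>x. l2_l2_guarantee n k \<epsilon> x (est A x))" if "A \<in> F" for A
    by (rule measurable_l2_l2_guarantee[OF id est[OF that]])
  have good': "Measurable.pred ?P (\<lambda>w. l2_l2_guarantee n k \<epsilon> (?X w) (est A (?X w)))" if "A \<in> F" for A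
    using measurable_compose[OF measurable_spiked_sum good[OF that]] by simp
  have Yset: "Measurable.pred ?P (\<lambda>w. fst w \<in> set_pmf ?Y)"
    by (rule measurable_compose[OF measurable_fst]) simp
  have Gset: "Measurable.pred ?P (\<lambda>w. G (snd w))"
    by (rule measurable_compose[OF measurable_snd G(1)])
  \<comment> \<open>Failure is cut down to possible sparse parts and good noise, so that
    \<open>fail\<close> bounds the count at every point.\<close>
  define D where "D A = {w\<in>space ?P. fst w \<in> set_pmf ?Y \<and> G (snd w) \<and>
    \<not> l2_l2_guarantee n k \<epsilon> (?X w) (est A (?X w))}" for A
  have D_sets: "D A \<in> sets ?P" if "A \<in> F" for A
    using good'[OF that] Yset Gset unfolding D_def by measurable
  have "\<exists>A\<in>F. measure ?P (D A) \<le> \<delta>\<^sub>2"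
  proof (rule exists_member_measure_le[OF YZ.prob_space_axioms F D_sets])
    fix w assume "w \<in> space ?P"
    show "real (card {A\<in>F. w \<in> D A}) \<le> \<delta>\<^sub>2 * real (card F)"
    proof (cases "fst w \<in> set_pmf ?Y \<and> G (snd w)")
      case True
      then show ?thesis
        using fail[of "fst w" "snd w" "?X w"] \<open>w \<in> space ?P\<close>
        by (simp add: D_def est_def case_prod_beta)
    next
      case False
      then have "{A\<in>F. w \<in> D A} = {}" by (auto simp: D_def)
      then show ?thesis using \<open>0 \<le> \<delta>\<^sub>2\<close> by (simp only: card.empty) simp
    qed
  qed
  then obtain A where A: "A \<in> F" "measure ?P (D A) \<le> \<delta>\<^sub>2" by blast
  let ?Q = "\<lambda>x. l2_l2_guarantee n k \<epsilon> x (est A x)"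
  \<comment> \<open>Failures outside \<open>D A\<close> lie in \<open>?U\<close>, a null set, or in
    \<open>?V\<close>, of measure at most \<open>\<delta>\<^sub>1\<close>.\<close>
  let ?U = "(- set_pmf ?Y) \<times> space (noise n)" and ?V = "UNIV \<times> {z\<in>space (noise n). \<not> G z}"
  have UV: "?U \<in> sets ?P" "?V \<in> sets ?P" using G(1) by auto
  have "measure ?P ?U = measure (measure_pmf ?Y) (- set_pmf ?Y) * measure (noise n) (space (noise n))"
    by (rule measure_Times[OF Z.prob_space_axioms]) auto
  also have "measure (measure_pmf ?Y) (- set_pmf ?Y) = 0"
    by (simp add: measure_pmf_zero_iff)
  finally have U: "measure ?P ?U = 0" by simp
  have "measure ?P ?V = measure (measure_pmf ?Y) UNIV * measure (noise n) {z\<in>space (noise n). \<not> G z}"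
    using G(1) by (intro measure_Times[OF Z.prob_space_axioms]) auto
  then have V: "measure ?P ?V \<le> \<delta>\<^sub>1" using G(2) by simp
  have "measure ?P {w\<in>space ?P. \<not> ?Q (?X w)} \<le> measure ?P (?U \<union> ?V \<union> D A)"
    using UV D_sets[OF A(1)]
    by (intro YZ.finite_measure_mono) (auto simp: D_def space_pair_measure)
  also have "\<dots> \<le> measure ?P (?U \<union> ?V) + measure ?P (D A)"
    using UV D_sets[OF A(1)] by (intro measure_Un_le) auto
  also have "measure ?P (?U \<union> ?V) \<le> measure ?P ?U + measure ?P ?V"
    using UV by (intro measure_Un_le) auto
  finally have bad: "measure ?P {w\<in>space ?P. \<not> ?Q (?X w)} \<le> \<delta>\<^sub>1 + \<delta>\<^sub>2"
    using U V A(2) by simp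
  \<comment> \<open>The seed is a point mass at an arbitrary value: the matrix \<open>A\<close> is
    already fixed.\<close>
  define S where "S = return (count_space UNIV) (undefined :: nat \<Rightarrow> real)"
  define R where "R = \<lparr>seed = S, sensing_matrix = \<lambda>_. A, decoder = \<lambda>_. dec A\<rparr>"
  have S: "prob_space S" unfolding S_def by (rule prob_space_return) simp
  interpret S: prob_space S by (rule S)
  have "(\<lambda>p. dec A (snd p)) \<in> S \<Otimes>\<^sub>M borel_vec m \<rightarrow>\<^sub>M borel_vec n"
    by (rule measurable_compose[OF measurable_snd dec[OF A(1)]])
  then have R: "is_sensing_scheme m n R"
    using S by (simp add: is_sensing_scheme_def R_def case_prod_beta)
  have est_R: "estimate m n R w x = est A x" for w x
    by (simp add: estimate_def measurements_def R_def est_def)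
  have "Measurable.pred ?D ?Q"
    using good[OF A(1)] by (simp add: measurable_cong_sets[OF sets_spiked_covariance refl])
  then have Q: "{x\<in>space ?D. ?Q x} \<in> sets ?D" by (rule predE)
  have rect: "{(w, x) \<in> space (S \<Otimes>\<^sub>M ?D). ?Q x} = space S \<times> {x\<in>space ?D. ?Q x}"
    by (auto simp: space_pair_measure)
  have "\<P>((w, x) in S \<Otimes>\<^sub>M ?D. ?Q x) = measure S (space S) * measure ?D {x\<in>space ?D. ?Q x}"
    unfolding rect by (rule measure_Times[OF D.prob_space_axioms sets.top Q])
  also have "\<dots> = measure ?D {x\<in>space ?D. ?Q x}" by (simp add: S.prob_space)
  also have "\<dots> = measure ?P {w\<in>space ?P. ?Q (?X w)}"
  proof -
    have "?X -` {x\<in>space (borel_vec n). ?Q x} \<inter> space ?P = {w\<in>space ?P. ?Q (?X w)}"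
      using measurable_space[OF measurable_spiked_sum[of n k \<epsilon>]] by blast
    then show ?thesis
      using good[OF A(1)] measure_distr[OF measurable_spiked_sum[of n k \<epsilon>], of "{x\<in>space (borel_vec n). ?Q x}"]
      by (simp add: spiked_covariance_def)
  qed
  also have "\<dots> = 1 - measure ?P {w\<in>space ?P. \<not> ?Q (?X w)}"
    using YZ.prob_neg[of "\<lambda>w. ?Q (?X w)"] good'[OF A(1)] by (simp add: pred_def)
  also have "\<dots> \<ge> 1 - (\<delta>\<^sub>1 + \<delta>\<^sub>2)" using bad by simp
  finally have "\<P>((w, x) in S \<Otimes>\<^sub>M ?D. ?Q x) \<ge> 1 - (\<delta>\<^sub>1 + \<delta>\<^sub>2)" .
  moreover have "seed R = S" by (simp add: R_def)
  ultimately show ?thesis using R by (intro exI[of _ R]) (simp add: est_R)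
qed

section \<open>Noise on all k-subsets and comparison of energies\<close>

text \<open>The positions of the \<open>k\<close> largest coordinates depend on the signal, so the
  chi-square tail must hold for all k-subsets at once; a union bound pays the binomial
  coefficient.\<close>

lemma noise_subsets_upper_tail:
  fixes a :: real
  assumes "1 \<le> k" "k \<le> n"
  shows "measure (noise n) (\<Union>T\<in>{T. T \<subseteq> {..<n} \<and> card T = k}.
      {z\<in>space (noise n). a \<le> real n * (\<Sum>i\<in>T. (z i)\<^sup>2)}) \<le>
    exp (real k * (1 + ln (real n / real k)) + real k / 2 - a / 4)"
proof -
  let ?I = "{T. T \<subseteq> {..<n} \<and> card T = k}"
  let ?E = "\<lambda>T. {z\<in>space (noise n). a \<le> real n * (\<Sum>i\<in>T. (z i)\<^sup>2)}"
  interpret prob_space "noise n" using assms by (intro prob_space_noise) simp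
  have I: "finite ?I" by (rule finite_subset[of _ "Pow {..<n}"]) auto
  have E: "?E T \<in> sets (noise n)" if "T \<in> ?I" for T
  proof -
    have [measurable]: "(\<lambda>z. \<Sum>i\<in>T. (z i)\<^sup>2) \<in> borel_measurable (noise n)"
      using that by (intro borel_measurable_sum_squares_noise) auto
    show ?thesis by measurable
  qed
  have "measure (noise n) (\<Union>T\<in>?I. ?E T) \<le> (\<Sum>T\<in>?I. measure (noise n) (?E T))"
    using E by (intro finite_measure_subadditive_finite I) auto
  also have "\<dots> \<le> (\<Sum>T\<in>?I. exp (real k / 2 - a / 4))"
  proof (rule sum_mono)
    fix T assume "T \<in> ?I"
    then show "measure (noise n) (?E T) \<le> exp (real k / 2 - a / 4)"
      using noise_sum_squares_upper_tail[of n T a] assms by auto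
  qed
  also have "\<dots> = real (n choose k) * exp (real k / 2 - a / 4)"
    using n_subsets[of "{..<n}" k] by simp
  also have "\<dots> \<le> exp (real k * (1 + ln (real n / real k))) * exp (real k / 2 - a / 4)"
    by (intro mult_right_mono binomial_le_exp assms) auto
  also have "\<dots> = exp (real k * (1 + ln (real n / real k)) + real k / 2 - a / 4)"
    by (simp flip: exp_add)
  finally show ?thesis .
qed

lemma pred_noise_sum_squares:
  assumes "T \<subseteq> {..<n}"
  shows "Measurable.pred (noise n) (\<lambda>z. a \<le> real n * (\<Sum>i\<in>T. (z i)\<^sup>2))"
    and "Measurable.pred (noise n) (\<lambda>z. real n * (\<Sum>i\<in>T. (z i)\<^sup>2) \<le> a)"
proof -
  note [measurable] = borel_measurable_sum_squares_noise[OF assms]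
  show "Measurable.pred (noise n) (\<lambda>z. a \<le> real n * (\<Sum>i\<in>T. (z i)\<^sup>2))"
    and "Measurable.pred (noise n) (\<lambda>z. real n * (\<Sum>i\<in>T. (z i)\<^sup>2) \<le> a)"
    by measurable
qed

lemma pred_noise_subsets:
  "Measurable.pred (noise n)
    (\<lambda>z. \<forall>T\<in>{T. T \<subseteq> {..<n} \<and> card T = k}. \<not> a \<le> real n * (\<Sum>i\<in>T. (z i)\<^sup>2))"
proof (rule pred_intros_finite)
  show "finite {T. T \<subseteq> {..<n} \<and> card T = k}"
    by (rule finite_subset[of _ "Pow {..<n}"]) auto
qed (auto intro!: pred_intros_logic(2) pred_noise_sum_squares(1))

text \<open>The sparse part can cancel noise only on its support \<open>S\<close>, so replacing
  \<open>z\<close> by \<open>x\<close> loses at most the noise energy on \<open>S\<close>.\<close>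

lemma sum_squares_le_off_support:
  fixes x z :: "nat \<Rightarrow> real"
  assumes "finite U" "finite S" "\<And>i. i \<in> U - S \<Longrightarrow> x i = z i"
  shows "(\<Sum>i\<in>U. (z i)\<^sup>2) \<le> (\<Sum>i\<in>U. (x i)\<^sup>2) + (\<Sum>i\<in>S. (z i)\<^sup>2)"
proof -
  have "(\<Sum>i\<in>U. (z i)\<^sup>2) = (\<Sum>i\<in>U - S. (z i)\<^sup>2) + (\<Sum>i\<in>U \<inter> S. (z i)\<^sup>2)"
    using assms(1) by (metis add.commute sum.Int_Diff)
  also have "(\<Sum>i\<in>U - S. (z i)\<^sup>2) = (\<Sum>i\<in>U - S. (x i)\<^sup>2)"
    using assms(3) by (intro sum.cong) auto
  also have "\<dots> \<le> (\<Sum>i\<in>U. (x i)\<^sup>2)"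
    using assms(1) by (intro sum_mono2) auto
  also have "(\<Sum>i\<in>U \<inter> S. (z i)\<^sup>2) \<le> (\<Sum>i\<in>S. (z i)\<^sup>2)"
    using assms(2) by (intro sum_mono2) auto
  finally show ?thesis by simp
qed

text \<open>Weighted AM-GM on the support of \<open>v\<close>, where the noise is small. The weight
  \<open>a\<close> is free: 1/2 serves the error bound and 1/8 the separation bound of the
  decoder.\<close>

lemma inner_le_on_support:
  fixes v z :: "nat \<Rightarrow> real"
  assumes "0 < a" "U \<subseteq> {..<n}" "\<And>i. i \<notin> U \<Longrightarrow> v i = 0"
  shows "(\<Sum>i<n. v i * z i) \<le> a * (\<Sum>i<n. (v i)\<^sup>2) + (\<Sum>i\<in>U. (z i)\<^sup>2) / (4 * a)"
proof -
  have "(\<Sum>i<n. v i * z i) = (\<Sum>i\<in>U. v i * z i)"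
    using assms by (intro sum.mono_neutral_right) auto
  also have "\<dots> \<le> (\<Sum>i\<in>U. a * (v i)\<^sup>2 + (z i)\<^sup>2 / (4 * a))"
  proof (rule sum_mono)
    fix i
    have "0 \<le> (2 * a * v i - z i)\<^sup>2 / (4 * a)" using assms(1) by simp
    also have "\<dots> = a * (v i)\<^sup>2 + (z i)\<^sup>2 / (4 * a) - v i * z i"
      using assms(1) by (simp add: power2_eq_square field_simps)
    finally show "v i * z i \<le> a * (v i)\<^sup>2 + (z i)\<^sup>2 / (4 * a)" by simp
  qed
  also have "\<dots> = a * (\<Sum>i\<in>U. (v i)\<^sup>2) + (\<Sum>i\<in>U. (z i)\<^sup>2) / (4 * a)"
    by (simp add: sum.distrib sum_distrib_left sum_divide_distrib)
  also have "(\<Sum>i\<in>U. (v i)\<^sup>2) = (\<Sum>i<n. (v i)\<^sup>2)"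
    using assms by (intro sum.mono_neutral_left) auto
  finally show ?thesis .
qed

subsection \<open>Direct measurement of coordinates\<close>

text \<open>Copying the first \<open>m\<close> coordinates leaves exactly the energy of the others
  as error. If the first \<open>m\<close> carry at least the energy of the \<open>k\<close> largest,
  that error is at most the tail energy, even without the factor 1 + \<epsilon>.\<close>

lemma exists_coordinate_scheme:
  assumes "n > 0" "m \<le> n" "0 \<le> \<epsilon>"
    and G: "Measurable.pred (noise n) G" "measure (noise n) {z\<in>space (noise n). \<not> G z} \<le> \<delta>"
    and dom: "\<And>y z x. y \<in> set_pmf (sparse_part n k \<epsilon>) \<Longrightarrow> G z \<Longrightarrow> (\<And>i. i < n \<Longrightarrow> x i = y i + z i) \<Longrightarrow>
      (\<Sum>i\<in>largest_coords n k x. (x i)\<^sup>2) \<le> (\<Sum>i<m. (x i)\<^sup>2)"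
  shows "\<exists>R :: (nat \<Rightarrow> real) sensing_scheme. is_sensing_scheme m n R \<and>
    \<P>((w, x) in seed R \<Otimes>\<^sub>M spiked_covariance n k \<epsilon>.
       l2_l2_guarantee n k \<epsilon> x (estimate m n R w x)) \<ge> 1 - \<delta>"
proof -
  define A where "A i j = (if i = j then 1 else 0 :: real)" for i j :: nat
  define dec where "dec B u = (\<lambda>i\<in>{..<n}. if i < m then u i else 0 :: real)"
    for B :: "nat \<Rightarrow> nat \<Rightarrow> real" and u
  have "dec B \<in> borel_vec m \<rightarrow>\<^sub>M borel_vec n" for B
    unfolding dec_def
  proof (rule measurable_restrict)
    fix i
    show "(\<lambda>u. if i < m then u i else 0 :: real) \<in> borel_vec m \<rightarrow>\<^sub>M borel"
      using measurable_component_singleton[of i "{..<m}" "\<lambda>_. borel"] by (cases "i < m") auto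
  qed
  moreover have "l2_l2_guarantee n k \<epsilon> x (dec A (\<lambda>i\<in>{..<m}. \<Sum>j<n. A i j * x j))"
    if "y \<in> set_pmf (sparse_part n k \<epsilon>)" "G z" "\<And>i. i < n \<Longrightarrow> x i = y i + z i" for y z x
  proof -
    have "(\<Sum>j<n. A i j * x j) = x i" if "i < m" for i
    proof -
      have "(\<Sum>j<n. A i j * x j) = (\<Sum>j<n. if i = j then x j else 0)"
        by (intro sum.cong) (auto simp: A_def)
      then show ?thesis using that assms(2) by simp
    qed
    then have "dec A (\<lambda>i\<in>{..<m}. \<Sum>j<n. A i j * x j) = (\<lambda>i\<in>{..<n}. if i < m then x i else 0)"
      by (auto simp: dec_def fun_eq_iff)
    then have "(L2_set (\<lambda>i. dec A (\<lambda>i\<in>{..<m}. \<Sum>j<n. A i j * x j) i - x i) {..<n})\<^sup>2 =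
        (\<Sum>i<n. (x i)\<^sup>2 - (if i < m then (x i)\<^sup>2 else 0))"
      unfolding L2_set_square_lessThan by (intro sum.cong) auto
    also have "\<dots> = (\<Sum>i<n. (x i)\<^sup>2) - (\<Sum>i<m. (x i)\<^sup>2)"
    proof -
      have "{i. i < n \<and> i < m} = {..<m}" using assms(2) by auto
      then show ?thesis by (simp add: sum_subtractf sum.If_cases Int_def)
    qed
    also have "\<dots> \<le> (L2_set (zero_largest n k x) {..<n})\<^sup>2"
      unfolding L2_set_zero_largest_square using dom[OF that] by simp
    also have "\<dots> \<le> (1 + \<epsilon>) * (L2_set (zero_largest n k x) {..<n})\<^sup>2"
      using assms(3) by (simp add: distrib_right)
    finally show ?thesis by (simp add: l2_l2_guarantee_def)
  qed
  ultimately show ?thesis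
    \<comment> \<open>The family is a singleton whose member never fails on \<open>G\<close>, so the
      second failure term is 0.\<close>
    using exists_deterministic_scheme[of n "{A}" dec m G \<delta> 0 k \<epsilon>] assms(1) G by simp
qed

lemma exists_direct_scheme:
  fixes \<tau> :: real
  assumes k: "1 \<le> k" "k \<le> n" and m: "m \<le> n" and \<epsilon>: "0 < \<epsilon>" and \<tau>: "1 \<le> \<tau>"
    and large: "2 * (real k * (1 + ln (real n / real k))) + 3 * \<tau> \<le> real m / 64"
      "32 * \<epsilon> * real n \<le> 5 * real m"
  shows "\<exists>R :: (nat \<Rightarrow> real) sensing_scheme. is_sensing_scheme m n R \<and>
    \<P>((w, x) in seed R \<Otimes>\<^sub>M spiked_covariance n k \<epsilon>.
       l2_l2_guarantee n k \<epsilon> x (estimate m n R w x)) \<ge> 1 - exp (- \<tau>)"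
proof -
  define l where "l = real k * (1 + ln (real n / real k))"
  let ?I = "{T. T \<subseteq> {..<n} \<and> card T = k}"
  let ?small = "\<lambda>z. \<forall>T\<in>?I. \<not> real m / 16 \<le> real n * (\<Sum>i\<in>T. (z i)\<^sup>2)"
  let ?low = "\<lambda>z. real n * (\<Sum>i<m. (z i)\<^sup>2) \<le> real m / 2"
  define G where "G z \<longleftrightarrow> ?small z \<and> \<not> ?low z" for z
  interpret prob_space "noise n" using k by (intro prob_space_noise) simp
  have n: "n > 0" using k by simp
  have l: "real k \<le> l" using k by (auto simp: l_def)
  have low: "Measurable.pred (noise n) ?low"
    using m by (intro pred_noise_sum_squares) auto
  have pred: "Measurable.pred (noise n) G"
    unfolding G_def using pred_noise_subsets low by measurable
  let ?A = "\<Union>T\<in>?I. {z\<in>space (noise n). real m / 16 \<le> real n * (\<Sum>i\<in>T. (z i)\<^sup>2)}"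
  let ?B = "{z\<in>space (noise n). ?low z}"
  have A: "?A = {z\<in>space (noise n). \<not> ?small z}" by blast
  have sets: "?A \<in> sets (noise n)" "?B \<in> sets (noise n)"
    unfolding A using pred_noise_subsets low by measurable
  have "{z\<in>space (noise n). \<not> G z} = ?A \<union> ?B" by (auto simp: G_def)
  then have "measure (noise n) {z\<in>space (noise n). \<not> G z} \<le> measure (noise n) ?A + measure (noise n) ?B"
    using measure_Un_le[OF sets] by simp
  also have "\<dots> \<le> exp (l + real k / 2 - real m / 16 / 4) + exp (- real m / 12)"
    using noise_subsets_upper_tail[OF k, of "real m / 16"] noise_sum_squares_lower_tail[of n "{..<m}"] m n
    by (intro add_mono) (auto simp: l_def)
  \<comment> \<open>As k <= l, the first exponent is at most l + k/2 - (2l + 3\<tau>) <= -3\<tau>,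
    and \<tau> >= 1 turns this into -\<tau> - 2.\<close>
  also have "\<dots> \<le> exp (- \<tau> - 2) + exp (- \<tau> - 2)"
    using large(1) l \<tau> k unfolding l_def[symmetric] by (intro add_mono) auto
  also have "\<dots> = exp (- \<tau>) * (2 * exp (- 2))"
    by (simp add: exp_diff exp_minus field_simps)
  also have "\<dots> \<le> exp (- \<tau>) * 1"
    using exp_ge_add_one_self[of 2] by (intro mult_left_mono) (auto simp: exp_minus field_simps)
  finally have prob: "measure (noise n) {z\<in>space (noise n). \<not> G z} \<le> exp (- \<tau>)" by simp
  show ?thesis
  proof (rule exists_coordinate_scheme[OF n m _ pred prob])
    fix y z x :: "nat \<Rightarrow> real"
    assume y: "y \<in> set_pmf (sparse_part n k \<epsilon>)" and G: "G z" and x: "\<And>i. i < n \<Longrightarrow> x i = y i + z i"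
    obtain S where S: "S \<subseteq> {..<n}" "card S = k" "\<And>i. i \<notin> S \<Longrightarrow> y i = 0" "(\<Sum>i<n. (y i)\<^sup>2) = \<epsilon>"
      using sparse_partE[OF y k \<epsilon>] by blast
    define T where "T = largest_coords n k x"
    have T: "T \<subseteq> {..<n}" "card T = k"
      using card_largest_coords[OF k(2)] by (auto simp: T_def largest_coords_def)
    have zT: "real n * (\<Sum>i\<in>T. (z i)\<^sup>2) < real m / 16" and zS: "real n * (\<Sum>i\<in>S. (z i)\<^sup>2) < real m / 16"
      using G T S(1,2) unfolding G_def not_le by blast+
    have zm: "real m / 2 < real n * (\<Sum>i<m. (z i)\<^sup>2)" using G unfolding G_def not_le by blast
    have "(\<Sum>i\<in>T. (x i)\<^sup>2) \<le> (\<Sum>i\<in>T. 2 * (y i)\<^sup>2 + 2 * (z i)\<^sup>2)"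
    proof (rule sum_mono)
      fix i assume "i \<in> T"
      then have "x i = y i + z i" using T x by auto
      then show "(x i)\<^sup>2 \<le> 2 * (y i)\<^sup>2 + 2 * (z i)\<^sup>2"
        using sum_squares_bound[of "y i" "z i"] by (simp add: power2_sum)
    qed
    also have "\<dots> = 2 * (\<Sum>i\<in>T. (y i)\<^sup>2) + 2 * (\<Sum>i\<in>T. (z i)\<^sup>2)"
      by (simp add: sum.distrib sum_distrib_left)
    also have "(\<Sum>i\<in>T. (y i)\<^sup>2) \<le> \<epsilon>"
      unfolding S(4)[symmetric] using T by (intro sum_mono2) auto
    finally have "real n * (\<Sum>i\<in>T. (x i)\<^sup>2) \<le> real n * (2 * \<epsilon> + 2 * (\<Sum>i\<in>T. (z i)\<^sup>2))"
      by (intro mult_left_mono) auto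
    then have 1: "real n * (\<Sum>i\<in>T. (x i)\<^sup>2) \<le> 2 * (\<epsilon> * real n) + 2 * (real n * (\<Sum>i\<in>T. (z i)\<^sup>2))"
      by (simp add: algebra_simps)
    have "(\<Sum>i<m. (z i)\<^sup>2) \<le> (\<Sum>i<m. (x i)\<^sup>2) + (\<Sum>i\<in>S. (z i)\<^sup>2)"
      using S x m finite_subset[OF S(1)] by (intro sum_squares_le_off_support) auto
    then have "real n * (\<Sum>i<m. (z i)\<^sup>2) \<le> real n * ((\<Sum>i<m. (x i)\<^sup>2) + (\<Sum>i\<in>S. (z i)\<^sup>2))"
      by (intro mult_left_mono) auto
    then have 2: "real n * (\<Sum>i<m. (z i)\<^sup>2) \<le> real n * (\<Sum>i<m. (x i)\<^sup>2) + real n * (\<Sum>i\<in>S. (z i)\<^sup>2)"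
      by (simp add: algebra_simps)
    \<comment> \<open>After scaling by \<open>n\<close>, the left side is at most 2 \<epsilon> n +
      m/8 and the right side at least m/2 - m/16 = 7m/16; the bound 32 \<epsilon> n <= 5 m closes
      the gap.\<close>
    have "real n * (\<Sum>i\<in>T. (x i)\<^sup>2) \<le> real n * (\<Sum>i<m. (x i)\<^sup>2)"
      using 1 2 zT zS zm large(2) by linarith
    then show "(\<Sum>i\<in>largest_coords n k x. (x i)\<^sup>2) \<le> (\<Sum>i<m. (x i)\<^sup>2)"
      using n by (simp add: T_def)
  qed (use \<epsilon> in simp)
qed

subsection \<open>Correlation decoding\<close>

text \<open>Enumerating the finite set as a list and taking the least maximising index selects a
  maximiser measurably.\<close>

lemma measurable_argmax:
  fixes f :: "'b \<Rightarrow> 'a \<Rightarrow> real"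
  assumes "finite Y" "Y \<noteq> {}" "\<And>y. y \<in> Y \<Longrightarrow> f y \<in> borel_measurable M"
  obtains s where "s \<in> M \<rightarrow>\<^sub>M count_space UNIV" "\<And>u. s u \<in> Y" "\<And>u y. y \<in> Y \<Longrightarrow> f y u \<le> f (s u) u"
proof -
  obtain ys where ys: "set ys = Y" using finite_list[OF assms(1)] by blast
  let ?P = "\<lambda>i u. i < length ys \<and> (\<forall>j\<in>{..<length ys}. f (ys ! j) u \<le> f (ys ! i) u)"
  define idx where "idx u = (LEAST i. ?P i u)" for u
  have meas: "f (ys ! i) \<in> borel_measurable M" if "i < length ys" for i
    using assms(3) that ys nth_mem by blast
  have P: "Measurable.pred M (?P i)" for i
  proof (cases "i < length ys")
    case True
    have "Measurable.pred M (\<lambda>u. \<forall>j\<in>{..<length ys}. f (ys ! j) u \<le> f (ys ! i) u)"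
    proof (intro pred_intros_finite)
      fix j assume "j \<in> {..<length ys}"
      then have [measurable]: "f (ys ! i) \<in> borel_measurable M" "f (ys ! j) \<in> borel_measurable M"
        using True meas by auto
      show "Measurable.pred M (\<lambda>u. f (ys ! j) u \<le> f (ys ! i) u)" by measurable
    qed simp
    then show ?thesis using True by simp
  qed simp
  have "\<exists>i. ?P i u" for u
  proof -
    have "Max ((\<lambda>y. f y u) ` Y) \<in> (\<lambda>y. f y u) ` Y" using assms(1,2) by (intro Max_in) auto
    then obtain y where y: "y \<in> Y" "f y u = Max ((\<lambda>y. f y u) ` Y)" by auto
    then obtain i where i: "i < length ys" "ys ! i = y" using ys by (metis in_set_conv_nth)
    have "f (ys ! j) u \<le> f y u" if "j < length ys" for j
      using that y(2) ys assms(1) by (auto intro!: Max_ge)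
    with i show ?thesis by auto
  qed
  then have idx: "?P (idx u) u" for u
    unfolding idx_def by (rule LeastI_ex)
  show thesis
  proof (rule that[of "\<lambda>u. ys ! idx u"])
    have "(\<lambda>u. LEAST i. ?P i u) \<in> M \<rightarrow>\<^sub>M count_space UNIV"
      by (rule measurable_Least[OF P])
    then have "idx \<in> M \<rightarrow>\<^sub>M count_space UNIV"
      unfolding idx_def[abs_def] .
    then show "(\<lambda>u. ys ! idx u) \<in> M \<rightarrow>\<^sub>M count_space UNIV"
      by (rule measurable_compose) simp
    show "ys ! idx u \<in> Y" for u using idx[of u] nth_mem unfolding ys[symmetric] by blast
    show "f y u \<le> f (ys ! idx u) u" if "y \<in> Y" for u y
    proof -
      from that ys obtain j where "j < length ys" "ys ! j = y" by (auto simp: in_set_conv_nth)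
      then show ?thesis using idx[of u] by auto
    qed
  qed
qed

text \<open>\<open>n_large\<close> makes the noise regular except with probability about exp
  (-\<tau>); \<open>m_large\<close> pays for the union bound over wrong candidates, each of which
  wins for a fraction at most exp (- \<epsilon> m / 1310720) of the matrices.\<close>

lemma exists_compressed_scheme:
  fixes \<tau> :: real
  assumes k: "1 \<le> k" "k \<le> n" and \<epsilon>: "0 < \<epsilon>" "\<epsilon> < 1" and \<tau>: "1 \<le> \<tau>"
    and n_large: "2 * (real k * (1 + ln (real n / real k))) + 3 * \<tau> \<le> \<epsilon> * real n / 1024"
    and m_large: "1310720 * (2 * (real k * (1 + ln (real n / real k))) + 3 * \<tau>) \<le> \<epsilon> * real m"
  shows "\<exists>R :: (nat \<Rightarrow> real) sensing_scheme. is_sensing_scheme m n R \<and>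
    \<P>((w, x) in seed R \<Otimes>\<^sub>M spiked_covariance n k \<epsilon>.
       l2_l2_guarantee n k \<epsilon> x (estimate m n R w x)) \<ge> 1 - exp (- \<tau>)"
proof -
  define l where "l = real k * (1 + ln (real n / real k))"
  have l: "real k \<le> l" using k by (auto simp: l_def)
  have n: "n > 0" using k by simp
  note n_large = n_large[folded l_def] and m_large = m_large[folded l_def]
  have "\<epsilon> * real n \<le> real n" using \<epsilon> mult_right_mono[of \<epsilon> 1 "real n"] by simp
  then have n_large': "3 * \<tau> \<le> real n / 1024" using n_large l k by linarith
  let ?I = "{T. T \<subseteq> {..<n} \<and> card T = k}"
  let ?a = "\<epsilon> * real n / 256"
  let ?small = "\<lambda>z. \<forall>T\<in>?I. \<not> ?a \<le> real n * (\<Sum>i\<in>T. (z i)\<^sup>2)"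
  let ?low = "\<lambda>z. real n * (\<Sum>i<n. (z i)\<^sup>2) \<le> real n / 2"
  let ?high = "\<lambda>z. 4 * real n \<le> real n * (\<Sum>i<n. (z i)\<^sup>2)"
  \<comment> \<open>On \<open>G\<close> the noise energy on any \<open>k\<close> coordinates is
    below \<epsilon> / 256, and its total lies between 1/2 and 4.\<close>
  define G where "G z \<longleftrightarrow> ?small z \<and> \<not> ?low z \<and> \<not> ?high z" for z
  interpret prob_space "noise n" using n by (rule prob_space_noise)
  have low: "Measurable.pred (noise n) ?low" by (intro pred_noise_sum_squares) auto
  have high: "Measurable.pred (noise n) ?high" by (intro pred_noise_sum_squares) auto
  have pred: "Measurable.pred (noise n) G"
    unfolding G_def using pred_noise_subsets low high by measurable
  let ?A = "\<Union>T\<in>?I. {z\<in>space (noise n). ?a \<le> real n * (\<Sum>i\<in>T. (z i)\<^sup>2)}"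
  let ?B = "{z\<in>space (noise n). ?low z}"
  let ?C = "{z\<in>space (noise n). ?high z}"
  have A: "?A = {z\<in>space (noise n). \<not> ?small z}" by blast
  have sets: "?A \<in> sets (noise n)" "?B \<in> sets (noise n)" "?C \<in> sets (noise n)"
    unfolding A using pred_noise_subsets low high by measurable
  have "{z\<in>space (noise n). \<not> G z} = ?A \<union> ?B \<union> ?C" by (auto simp: G_def)
  then have "measure (noise n) {z\<in>space (noise n). \<not> G z} \<le>
      measure (noise n) (?A \<union> ?B) + measure (noise n) ?C"
    using measure_Un_le[OF sets.Un[OF sets(1,2)] sets(3)] by simp
  also have "\<dots> \<le> measure (noise n) ?A + measure (noise n) ?B + measure (noise n) ?C"
    using measure_Un_le[OF sets(1,2)] by simp
  also have "\<dots> \<le> exp (l + real k / 2 - ?a / 4) + exp (- real n / 12) + exp (real n / 2 - 4 * real n / 4)"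
    using noise_subsets_upper_tail[OF k, of ?a] noise_sum_squares_lower_tail[OF n, of "{..<n}"]
      noise_sum_squares_upper_tail[OF n, of "{..<n}" "4 * real n"]
    by (intro add_mono) (auto simp: l_def)
  also have "\<dots> \<le> exp (- \<tau> - 2) + exp (- \<tau> - 2) + exp (- \<tau> - 2)"
    using n_large n_large' l \<tau> k by (intro add_mono) auto
  finally have prob: "measure (noise n) {z\<in>space (noise n). \<not> G z} \<le> 3 * exp (- \<tau> - 2)" by simp

  let ?Y = "set_pmf (sparse_part n k \<epsilon>)"
  let ?F = "sign_matrices m n"
  define score where "score A y u = (\<Sum>r<m. (\<Sum>i<n. A r i * y i) * u r)"
    for A :: "nat \<Rightarrow> nat \<Rightarrow> real" and y u :: "nat \<Rightarrow> real"
  have finY: "finite ?Y" using k \<epsilon> by (intro finite_set_pmf_sparse_part) auto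
  have "\<exists>s. s \<in> borel_vec m \<rightarrow>\<^sub>M count_space UNIV \<and> (\<forall>u. s u \<in> ?Y) \<and>
      (\<forall>u. \<forall>y\<in>?Y. score A y u \<le> score A (s u) u)" for A
  proof (rule measurable_argmax[OF finY set_pmf_not_empty, of "score A" "borel_vec m"])
    show "score A y \<in> borel_measurable (borel_vec m)" for y
      unfolding score_def
      by (intro borel_measurable_sum borel_measurable_times borel_measurable_const
          measurable_component_singleton) auto
  qed blast
  then obtain s where s: "\<And>A. s A \<in> borel_vec m \<rightarrow>\<^sub>M count_space UNIV" "\<And>A u. s A u \<in> ?Y"
    "\<And>A u y. y \<in> ?Y \<Longrightarrow> score A y u \<le> score A (s A u) u"
    by metis
  define dec where "dec A u = restrict (s A u) {..<n}" for A u
  have dec: "dec A \<in> borel_vec m \<rightarrow>\<^sub>M borel_vec n" for A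
  proof -
    have "(\<lambda>y. restrict y {..<n}) \<in> count_space UNIV \<rightarrow>\<^sub>M borel_vec n"
      unfolding measurable_count_space_eq1 space_PiM by (intro Pi_I restrict_PiE_iff[THEN iffD2]) auto
    then show ?thesis unfolding dec_def by (rule measurable_compose[OF s(1)])
  qed

  have fail: "real (card {A\<in>?F. \<not> l2_l2_guarantee n k \<epsilon> x (dec A (\<lambda>i\<in>{..<m}. \<Sum>j<n. A i j * x j))})
      \<le> exp (- \<tau> - 2) * real (card ?F)"
    if y: "y \<in> ?Y" and z: "G z" and x: "\<And>i. i < n \<Longrightarrow> x i = y i + z i" for x y z
  proof -
    define N where "N = (\<Sum>i<n. (z i)\<^sup>2)"
    define d where "d y' = (\<Sum>i<n. (y i - y' i)\<^sup>2)" for y'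
    have "real n / 2 < real n * N" "real n * N < 4 * real n"
      using z unfolding G_def N_def not_le by blast+
    then have "real n * (1 / 2) < real n * N" "real n * N < real n * 4" by linarith+
    then have N: "1 / 2 < N" "N < 4" using n by (simp_all only: mult_less_cancel_left_pos of_nat_0_less_iff)
    have small: "(\<Sum>i\<in>T. (z i)\<^sup>2) < \<epsilon> / 256" if "T \<subseteq> {..<n}" "card T = k" for T
    proof -
      have "real n * (\<Sum>i\<in>T. (z i)\<^sup>2) < \<epsilon> * real n / 256"
        using z that unfolding G_def not_le by blast
      then have "real n * (\<Sum>i\<in>T. (z i)\<^sup>2) < real n * (\<epsilon> / 256)" by (simp add: mult.commute)
      then show ?thesis using n by (simp only: mult_less_cancel_left_pos of_nat_0_less_iff)
    qed
    obtain S where S: "S \<subseteq> {..<n}" "card S = k" "\<And>i. i \<notin> S \<Longrightarrow> y i = 0" "(\<Sum>i<n. (y i)\<^sup>2) = \<epsilon>"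
      using sparse_partE[OF y k \<epsilon>(1)] by blast
    have union: "\<exists>U\<subseteq>{..<n}. (\<forall>i. i \<notin> U \<longrightarrow> y i - y' i = 0) \<and> (\<Sum>i\<in>U. (z i)\<^sup>2) \<le> \<epsilon> / 128"
      and norm: "(\<Sum>i<n. (y' i)\<^sup>2) = \<epsilon>" if y': "y' \<in> ?Y" for y'
    proof -
      obtain S' where S': "S' \<subseteq> {..<n}" "card S' = k" "\<And>i. i \<notin> S' \<Longrightarrow> y' i = 0" "(\<Sum>i<n. (y' i)\<^sup>2) = \<epsilon>"
        using sparse_partE[OF y' k \<epsilon>(1)] by blast
      have "(\<Sum>i\<in>S \<union> S'. (z i)\<^sup>2) \<le> (\<Sum>i\<in>S. (z i)\<^sup>2) + (\<Sum>i\<in>S'. (z i)\<^sup>2)"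
        using sum.union_inter[OF finite_subset[OF S(1)] finite_subset[OF S'(1)], of "\<lambda>i. (z i)\<^sup>2"]
          sum_nonneg[of "S \<inter> S'" "\<lambda>i. (z i)\<^sup>2"] by simp
      then have "(\<Sum>i\<in>S \<union> S'. (z i)\<^sup>2) \<le> \<epsilon> / 128"
        using small[OF S(1,2)] small[OF S'(1,2)] by simp
      then show "\<exists>U\<subseteq>{..<n}. (\<forall>i. i \<notin> U \<longrightarrow> y i - y' i = 0) \<and> (\<Sum>i\<in>U. (z i)\<^sup>2) \<le> \<epsilon> / 128"
        using S S' by (intro exI[of _ "S \<union> S'"]) auto
      show "(\<Sum>i<n. (y' i)\<^sup>2) = \<epsilon>" by fact
    qed
    \<comment> \<open>The error is at most N + \<epsilon>/4 + \<epsilon>/128 and the tail energy at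
      least N - \<epsilon>/128. The slack \<epsilon> N > \<epsilon>/2 gained from the factor 1 +
      \<epsilon> covers the difference.\<close>
    have close: "l2_l2_guarantee n k \<epsilon> x (restrict y' {..<n})" if y': "y' \<in> ?Y" "d y' < \<epsilon> / 8" for y'
    proof -
      obtain U where U: "U \<subseteq> {..<n}" "\<And>i. i \<notin> U \<Longrightarrow> y i - y' i = 0" "(\<Sum>i\<in>U. (z i)\<^sup>2) \<le> \<epsilon> / 128"
        using union[OF y'(1)] by blast
      have "(\<Sum>i<n. (y i - y' i) * z i) \<le> 1 / 2 * d y' + (\<Sum>i\<in>U. (z i)\<^sup>2) / (4 * (1 / 2))"
        unfolding d_def by (rule inner_le_on_support[OF _ U(1,2)]) auto
      then have cross: "2 * (\<Sum>i<n. (y i - y' i) * z i) \<le> d y' + \<epsilon> / 128" using U(3) by simp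
      have "(L2_set (\<lambda>i. restrict y' {..<n} i - x i) {..<n})\<^sup>2 =
          (\<Sum>i<n. (y i - y' i)\<^sup>2 + 2 * ((y i - y' i) * z i) + (z i)\<^sup>2)"
        unfolding L2_set_square_lessThan
        by (intro sum.cong refl) (auto simp: x power2_eq_square algebra_simps)
      also have "\<dots> = d y' + 2 * (\<Sum>i<n. (y i - y' i) * z i) + N"
        by (simp add: sum.distrib d_def N_def flip: sum_distrib_left)
      also have "\<dots> \<le> N + \<epsilon> / 4 + \<epsilon> / 128" using cross y'(2) by simp
      finally have err: "(L2_set (\<lambda>i. restrict y' {..<n} i - x i) {..<n})\<^sup>2 \<le> N + \<epsilon> / 4 + \<epsilon> / 128" .
      define T where "T = largest_coords n k x"
      have T: "T \<subseteq> {..<n}" "card T = k"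
        using card_largest_coords[OF k(2)] by (auto simp: T_def largest_coords_def)
      have "(\<Sum>i\<in>{..<n} - T. (z i)\<^sup>2) \<le> (\<Sum>i\<in>{..<n} - T. (x i)\<^sup>2) + (\<Sum>i\<in>S. (z i)\<^sup>2)"
        using S finite_subset[OF S(1)] x by (intro sum_squares_le_off_support) auto
      then have "N - \<epsilon> / 128 \<le> (L2_set (zero_largest n k x) {..<n})\<^sup>2"
        unfolding L2_set_zero_largest_square T_def[symmetric] N_def
        using T small[OF S(1,2)] small[OF T] by (simp add: sum_diff)
      then have "(1 + \<epsilon>) * (N - \<epsilon> / 128) \<le> (1 + \<epsilon>) * (L2_set (zero_largest n k x) {..<n})\<^sup>2"
        using \<epsilon> by (intro mult_left_mono) auto
      moreover have "N + \<epsilon> / 4 + \<epsilon> / 128 \<le> (1 + \<epsilon>) * (N - \<epsilon> / 128)"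
      proof -
        have "\<epsilon> * (1 / 2) \<le> \<epsilon> * N" "\<epsilon> * \<epsilon> \<le> \<epsilon> * 1"
          using N \<epsilon> by (auto intro!: mult_left_mono)
        moreover have "(1 + \<epsilon>) * (N - \<epsilon> / 128) = N + \<epsilon> * N - \<epsilon> / 128 - \<epsilon> * \<epsilon> / 128"
          by (simp add: algebra_simps)
        ultimately show ?thesis using \<epsilon> by linarith
      qed
      ultimately show ?thesis using err by (simp add: l2_l2_guarantee_def)
    qed

    let ?X = "\<lambda>A y'. \<Sum>r<m. (\<Sum>i<n. A r i * (y i - y' i)) * (\<Sum>i<n. A r i * x i)"
    let ?Y' = "{y'\<in>?Y. \<epsilon> / 8 \<le> d y'}"
    have "{A\<in>?F. \<not> l2_l2_guarantee n k \<epsilon> x (dec A (\<lambda>i\<in>{..<m}. \<Sum>j<n. A i j * x j))} \<subseteq>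
        (\<Union>y'\<in>?Y'. {A\<in>?F. ?X A y' \<le> 0})"
    proof safe
      fix A assume A: "A \<in> ?F"
        "\<not> l2_l2_guarantee n k \<epsilon> x (dec A (\<lambda>i\<in>{..<m}. \<Sum>j<n. A i j * x j))"
      define u where "u = (\<lambda>i\<in>{..<m}. \<Sum>j<n. A i j * x j)"
      have "\<epsilon> / 8 \<le> d (s A u)"
        using A(2) close[OF s(2), of A u] unfolding dec_def u_def by (meson not_le)
      \<comment> \<open>The true sparse part is itself a candidate, so the maximiser scores at least
        as high and this difference is not positive.\<close>
      moreover have "?X A (s A u) = score A y u - score A (s A u) u"
        by (simp add: score_def u_def right_diff_distrib left_diff_distrib sum_subtractf)
      then have "?X A (s A u) \<le> 0" using s(3)[OF y, of A u] by simp
      ultimately show "A \<in> (\<Union>y'\<in>?Y'. {A\<in>?F. ?X A y' \<le> 0})"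
        using A(1) s(2) by blast
    qed
    then have "card {A\<in>?F. \<not> l2_l2_guarantee n k \<epsilon> x (dec A (\<lambda>i\<in>{..<m}. \<Sum>j<n. A i j * x j))} \<le>
        card (\<Union>y'\<in>?Y'. {A\<in>?F. ?X A y' \<le> 0})"
      using finY by (intro card_mono) auto
    also have "\<dots> \<le> (\<Sum>y'\<in>?Y'. card {A\<in>?F. ?X A y' \<le> 0})"
      using finY by (intro card_UN_le) auto
    finally have "real (card {A\<in>?F. \<not> l2_l2_guarantee n k \<epsilon> x (dec A (\<lambda>i\<in>{..<m}. \<Sum>j<n. A i j * x j))}) \<le>
        real (\<Sum>y'\<in>?Y'. card {A\<in>?F. ?X A y' \<le> 0})"
      by (simp only: of_nat_le_iff)
    also have "\<dots> = (\<Sum>y'\<in>?Y'. real (card {A\<in>?F. ?X A y' \<le> 0}))" by simp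
    also have "\<dots> \<le> (\<Sum>y'\<in>?Y'. exp (- (\<epsilon> * real m) / 1310720) * real (card ?F))"
    proof (rule sum_mono)
      fix y' assume "y' \<in> ?Y'"
      then have y': "y' \<in> ?Y" "\<epsilon> / 8 \<le> d y'" by auto
      obtain U where U: "U \<subseteq> {..<n}" "\<And>i. i \<notin> U \<Longrightarrow> y i - y' i = 0" "(\<Sum>i\<in>U. (z i)\<^sup>2) \<le> \<epsilon> / 128"
        using union[OF y'(1)] by blast
      have d: "0 < d y'" using y'(2) \<epsilon> by linarith
      \<comment> \<open>Weight 1/8 leaves a noise term of at most 2 * \<epsilon> / 128 = \<epsilon>
        / 64, itself at most d/8 because d >= \<epsilon> / 8.\<close>
      have "(\<Sum>i<n. (y i - y' i) * - z i) \<le> 1 / 8 * d y' + (\<Sum>i\<in>U. (- z i)\<^sup>2) / (4 * (1 / 8))"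
        unfolding d_def by (rule inner_le_on_support[OF _ U(1,2)]) auto
      then have cross: "- (\<Sum>i<n. (y i - y' i) * z i) \<le> d y' / 4"
        using U(3) y'(2) by (simp add: sum_negf)
      \<comment> \<open>The norms of \<open>y\<close> and \<open>y'\<close> cancel, so the inner
        product with \<open>x\<close> is d/2 plus the noise term, hence at least d/4.\<close>
      have "(\<Sum>i<n. 2 * ((y i - y' i) * x i)) =
          (\<Sum>i<n. (y i)\<^sup>2 - (y' i)\<^sup>2 + (y i - y' i)\<^sup>2 + 2 * ((y i - y' i) * z i))"
        by (intro sum.cong refl) (simp add: x power2_eq_square algebra_simps)
      then have "2 * (\<Sum>i<n. (y i - y' i) * x i) = d y' + 2 * (\<Sum>i<n. (y i - y' i) * z i)"
        using norm[OF y'(1)] S(4)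
        by (simp add: sum.distrib sum_subtractf d_def flip: sum_distrib_left)
      then have ip: "d y' / 4 \<le> (\<Sum>i<n. (y i - y' i) * x i)" using cross by simp
      have "(\<Sum>i<n. (x i)\<^sup>2) \<le> (\<Sum>i<n. 2 * (y i)\<^sup>2 + 2 * (z i)\<^sup>2)"
      proof (rule sum_mono)
        fix i assume "i \<in> {..<n}"
        then show "(x i)\<^sup>2 \<le> 2 * (y i)\<^sup>2 + 2 * (z i)\<^sup>2"
          using sum_squares_bound[of "y i" "z i"] x[of i] by (simp add: power2_sum)
      qed
      then have xn: "(\<Sum>i<n. (x i)\<^sup>2) \<le> 10"
        using N \<epsilon> S(4) by (simp add: sum.distrib N_def flip: sum_distrib_left)
      \<comment> \<open>The Chernoff exponent with P = d and Q = 10 contains (d/4)^2 / (10 d) = d /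
        160 >= \<epsilon> / 1280, and 1280 * 1024 = 1310720.\<close>
      have "(d y' / 4)\<^sup>2 \<le> (\<Sum>i<n. (y i - y' i) * x i)\<^sup>2"
        using ip d by (intro power_mono) auto
      then have "(d y' / 4)\<^sup>2 / (d y' * 10) \<le> (\<Sum>i<n. (y i - y' i) * x i)\<^sup>2 / (d y' * 10)"
        using d by (intro divide_right_mono) auto
      moreover have "(d y' / 4)\<^sup>2 / (d y' * 10) = d y' / 160"
        using d by (simp add: power2_eq_square)
      ultimately have "\<epsilon> / 1280 \<le> (\<Sum>i<n. (y i - y' i) * x i)\<^sup>2 / (d y' * 10)"
        using y'(2) by simp
      then have "real m * (\<epsilon> / 1280) \<le> real m * ((\<Sum>i<n. (y i - y' i) * x i)\<^sup>2 / (d y' * 10))"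
        by (intro mult_left_mono) auto
      then have "exp (- real m * ((\<Sum>i<n. (y i - y' i) * x i)\<^sup>2 / (d y' * 10)) / 1024) \<le>
          exp (- (\<epsilon> * real m) / 1310720)"
        by (subst exp_le_cancel_iff) (simp add: mult.commute)
      moreover have "real (card {A\<in>?F. ?X A y' \<le> 0}) \<le>
          exp (- real m * ((\<Sum>i<n. (y i - y' i) * x i)\<^sup>2 / (d y' * 10)) / 1024) * real (card ?F)"
        using ip d xn by (intro card_sign_matrices_nonpos) (auto simp: d_def)
      ultimately show "real (card {A\<in>?F. ?X A y' \<le> 0}) \<le> exp (- (\<epsilon> * real m) / 1310720) * real (card ?F)"
        by (meson mult_right_mono of_nat_0_le_iff order.trans)
    qed
    also have "\<dots> \<le> real (card ?Y) * (exp (- (\<epsilon> * real m) / 1310720) * real (card ?F))"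
      using card_mono[OF finY, of ?Y'] by (simp add: mult_right_mono)
    also have "\<dots> \<le> exp (l + real k) * (exp (- (\<epsilon> * real m) / 1310720) * real (card ?F))"
      unfolding l_def using k \<epsilon> by (intro mult_right_mono card_set_pmf_sparse_part_le) auto
    also have "\<dots> = exp (l + real k + - (\<epsilon> * real m) / 1310720) * real (card ?F)"
      by (simp only: exp_add mult.assoc)
    also have "\<dots> \<le> exp (- \<tau> - 2) * real (card ?F)"
      using m_large l \<tau> by (intro mult_right_mono) auto
    finally show ?thesis .
  qed

  have F: "finite ?F" "?F \<noteq> {}"
    using card_sign_matrices[of m n] by (auto simp: card_gt_0_iff[symmetric])
  have "\<exists>R :: (nat \<Rightarrow> real) sensing_scheme. is_sensing_scheme m n R \<and>
    \<P>((w, x) in seed R \<Otimes>\<^sub>M spiked_covariance n k \<epsilon>.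
       l2_l2_guarantee n k \<epsilon> x (estimate m n R w x)) \<ge> 1 - (3 * exp (- \<tau> - 2) + exp (- \<tau> - 2))"
    by (rule exists_deterministic_scheme[OF n F dec pred prob exp_ge_zero], rule fail)
  then obtain R :: "(nat \<Rightarrow> real) sensing_scheme" where R: "is_sensing_scheme m n R"
    "\<P>((w, x) in seed R \<Otimes>\<^sub>M spiked_covariance n k \<epsilon>.
       l2_l2_guarantee n k \<epsilon> x (estimate m n R w x)) \<ge> 1 - (3 * exp (- \<tau> - 2) + exp (- \<tau> - 2))"
    by blast
  \<comment> \<open>Three noise events and one matrix event share the failure budget; exp 2 >= 5
    gives 4 * exp (-2) <= 1.\<close>
  have "3 * exp (- \<tau> - 2) + exp (- \<tau> - 2) = exp (- \<tau>) * (4 * exp (- 2))"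
    by (simp add: exp_diff exp_minus field_simps)
  also have "\<dots> \<le> exp (- \<tau>) * 1"
    using exp_lower_Taylor_quadratic[of 2]
    by (intro mult_left_mono) (auto simp: exp_minus field_simps)
  finally show ?thesis using R by (intro exI[of _ R]) auto
qed

section \<open>Choice of constants and of the scheme\<close>

theorem theorem13:
  shows "\<exists>\<beta> C :: real. 0 < \<beta> \<and> \<beta> < 1 \<and> 0 < C \<and>
    (\<forall>(n::nat) (k::nat) (\<epsilon>::real) (\<delta>::real).
       1 \<le> k \<longrightarrow> k \<le> n \<longrightarrow> 0 < \<epsilon> \<longrightarrow> \<epsilon> < 1 \<longrightarrow> 0 < \<delta> \<longrightarrow> \<delta> < 1 \<longrightarrow>
       (real k / \<epsilon>) * ln (1 / \<delta>) \<le> \<beta> * real n \<longrightarrow>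
       (\<exists>(m::nat) (R :: (nat \<Rightarrow> real) sensing_scheme).
          is_sensing_scheme m n R \<and>
          real m \<le> C * ((real k / \<epsilon>) * max 1 (ln (\<epsilon> * real n / real k)) + (1 / \<epsilon>) * ln (1 / \<delta>)) \<and>
          \<P>((w, x) in seed R \<Otimes>\<^sub>M spiked_covariance n k \<epsilon>.
             l2_l2_guarantee n k \<epsilon> x (estimate m n R w x)) \<ge> 1 - \<delta>))"
\<comment> \<open>6144 = 3 * 2048 turns the assumption into 3 D <= \<epsilon> n / 2048, half of what
  the compressed scheme needs. The threshold for \<open>L\<close> is 2^30 = 32768^2; doubling it to
  2^31 absorbs rounding.\<close>
proof (rule exI[of _ "1 / 6144"], rule exI[of _ "2147483648"], intro conjI allI impI)
  fix n k :: nat and \<epsilon> \<delta> :: real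
  assume k: "1 \<le> k" "k \<le> n" and \<epsilon>: "0 < \<epsilon>" "\<epsilon> < 1" and \<delta>: "0 < \<delta>" "\<delta> < 1"
    and cond: "(real k / \<epsilon>) * ln (1 / \<delta>) \<le> 1 / 6144 * real n"
  define L where "L = \<epsilon> * real n / real k"
  define M where "M = max 1 (ln L)"
  define D where "D = ln (1 / \<delta>)"
  define c where "c = real k / \<epsilon>"
  define a where "a = c * M"
  define b where "b = (1 / \<epsilon>) * D"
  define Q where "Q = a + b"
  define \<tau> where "\<tau> = max 1 D"
  define l where "l = real k * (1 + ln (real n / real k))"
  let ?ok = "\<lambda>m \<delta> (R :: (nat \<Rightarrow> real) sensing_scheme). is_sensing_scheme m n R \<and>
    \<P>((w, x) in seed R \<Otimes>\<^sub>M spiked_covariance n k \<epsilon>. l2_l2_guarantee n k \<epsilon> x (estimate m n R w x)) \<ge> 1 - \<delta>"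
  have D: "0 < D" using \<delta> by (simp add: D_def)
  have \<tau>: "1 \<le> \<tau>" "\<tau> \<le> 1 + D" using D by (auto simp: \<tau>_def)
  have exp\<tau>: "exp (- \<tau>) \<le> \<delta>"
  proof -
    have "exp (- \<tau>) \<le> exp (- D)" by (simp add: \<tau>_def)
    also have "\<dots> = \<delta>" using \<delta> by (simp add: D_def ln_div)
    finally show ?thesis .
  qed
  have M: "1 \<le> M" "ln L \<le> M" by (auto simp: M_def)
  have L: "0 < L" "\<epsilon> * real n = real k * L" "real n / real k = L / \<epsilon>"
    using k \<epsilon> by (auto simp: L_def)
  have k\<epsilon>: "1 \<le> c" using k \<epsilon> by (simp add: c_def field_simps)
  have kM: "c \<le> a" unfolding a_def using M k\<epsilon> mult_left_mono[of 1 M c] by simp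
  have D\<epsilon>: "D \<le> b" unfolding b_def using D \<epsilon> by (simp add: field_simps)
  have Q: "1 \<le> Q" "c \<le> Q" using kM k\<epsilon> D\<epsilon> D by (auto simp: Q_def)
  have "\<exists>m R. ?ok m \<delta> R \<and> real m \<le> 2147483648 * Q"
  proof (cases "1073741824 \<le> L \<and> 1 / \<epsilon> \<le> L")
    case True
    define m where "m = nat \<lceil>1310720 * (2 * l + 3 * \<tau>) / \<epsilon>\<rceil>"
    have lnL: "0 \<le> ln L" using True by auto
    \<comment> \<open>Here 1 / \<epsilon> <= L is used: n / k = L / \<epsilon> <= L^2.\<close>
    have "ln (L / \<epsilon>) \<le> ln (L * L)"
      using True L \<epsilon> by (intro ln_mono) (auto simp: field_simps)
    then have "ln (L / \<epsilon>) \<le> 2 * ln L" using L(1) by (simp add: ln_mult)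
    then have l: "l \<le> real k * (1 + 2 * ln L)"
      unfolding l_def L(3) by (intro mult_left_mono) auto
    also have "\<dots> \<le> real k * (3 * M)" using M by (intro mult_left_mono) auto
    finally have lM: "l \<le> 3 * (real k * M)" by simp
    have l0: "0 \<le> l" using k by (auto simp: l_def)
    have "real m \<le> 1310720 * (2 * l + 3 * \<tau>) / \<epsilon> + 1"
      unfolding m_def using l0 \<tau> \<epsilon> by (simp add: of_nat_nat)
    also have "\<dots> \<le> 1310720 * (2 * (3 * (real k * M)) + 3 * (1 + D)) / \<epsilon> + 1"
      using lM \<tau> \<epsilon> by (intro add_mono divide_right_mono mult_left_mono) auto
    also have "\<dots> = 7864320 * a + 3932160 * (1 / \<epsilon>) + 3932160 * b + 1"
      by (simp add: a_def b_def c_def add_divide_distrib distrib_left)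
    finally have "real m \<le> 7864320 * a + 3932160 * (1 / \<epsilon>) + 3932160 * b + 1" .
    moreover have "1 / \<epsilon> \<le> c" unfolding c_def using k \<epsilon> by (intro divide_right_mono) auto
    ultimately have m_le: "real m \<le> 2147483648 * Q"
      using kM k\<epsilon> D\<epsilon> D unfolding Q_def distrib_left by linarith
    have "1310720 * (2 * l + 3 * \<tau>) / \<epsilon> \<le> real m" unfolding m_def by linarith
    then have m_ge: "1310720 * (2 * l + 3 * \<tau>) \<le> \<epsilon> * real m" using \<epsilon> by (simp add: field_simps)
    have "2 * l + 3 * \<tau> \<le> \<epsilon> * real n / 1024"
    proof -
      \<comment> \<open>Passing to the square root gives ln L <= 2 s, so 2 + 4 ln L <= 16 s; this is
        at most s^2 / 2048 since s >= 16 * 2048 = 32768.\<close>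
      define s where "s = sqrt L"
      have s: "s * s = L" "32768 \<le> s"
        using True by (auto simp: s_def intro!: real_le_rsqrt)
      have "ln L = 2 * ln s" using L(1) by (simp add: s_def ln_sqrt)
      also have "\<dots> \<le> 2 * s" using ln_le_minus_one[of s] s(2) by simp
      finally have "2 + 4 * ln L \<le> 16 * s" using s(2) by simp
      also have "\<dots> \<le> L / 2048"
        using mult_right_mono[OF s(2), of s] s by simp
      finally have "real k * (2 + 4 * ln L) \<le> real k * (L / 2048)"
        by (intro mult_left_mono) auto
      then have 1: "2 * l \<le> \<epsilon> * real n / 2048" using l L(2) by (simp add: algebra_simps)
      have "real k * D \<le> \<epsilon> * real n / 6144"
        using cond \<epsilon> unfolding D_def[symmetric] by (simp add: field_simps)
      moreover have "D \<le> real k * D" using k D by simp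
      ultimately have "3 * D \<le> \<epsilon> * real n / 2048" by linarith
      moreover have "1 * 1073741824 \<le> real k * L" using True k by (intro mult_mono) auto
      ultimately have "3 * \<tau> \<le> \<epsilon> * real n / 2048" using L(2) by (simp add: \<tau>_def)
      with 1 show ?thesis by simp
    qed
    then obtain R where "?ok m (exp (- \<tau>)) R"
      using exists_compressed_scheme[OF k \<epsilon> \<tau>(1), of m] m_ge unfolding l_def by blast
    then have "?ok m \<delta> R" using exp\<tau> by auto
    with m_le show ?thesis by blast
  next
    case False
    define m where "m = min n (nat \<lceil>1073741824 * Q\<rceil>)"
    have "real m \<le> 1073741824 * Q + 1" unfolding m_def using Q(1) by (auto simp: min_def) linarith+
    then have m_le: "real m \<le> 2147483648 * Q" using Q(1) by simp
    show ?thesis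
    proof (cases "m = n")
      case True
      \<comment> \<open>Reading all coordinates needs no condition on the noise: the domination is
        mere inclusion of index sets, and failure has probability 0.\<close>
      have "\<exists>R. ?ok m 0 R"
      proof (rule exists_coordinate_scheme[where G = "\<lambda>_. True"])
        fix x :: "nat \<Rightarrow> real"
        show "(\<Sum>i\<in>largest_coords n k x. (x i)\<^sup>2) \<le> (\<Sum>i<m. (x i)\<^sup>2)"
          unfolding True by (intro sum_mono2) (auto simp: largest_coords_def)
      qed (use k \<epsilon> True in auto)
      then obtain R where "?ok m 0 R" by blast
      then have "?ok m \<delta> R" using \<delta> by auto
      with m_le show ?thesis by blast
    next
      case mn: False
      then have m: "m \<le> n" "1073741824 * Q \<le> real m" unfolding m_def by (auto simp: min_def) linarith+
      \<comment> \<open>Since L = n / c, a budget below \<open>n\<close> forces L >= 2^30, so the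
        failed case condition can only mean L < 1 / \<epsilon>.\<close>
      then have "1073741824 * c \<le> real n" using Q(2) by linarith
      then have "1073741824 \<le> L" using k \<epsilon> by (simp add: L_def c_def field_simps)
      then have L1: "L < 1 / \<epsilon>" using False by auto
      \<comment> \<open>Now n / k = L / \<epsilon> < 1 / \<epsilon>^2, so the logarithm is at most 2
        (1 / \<epsilon> - 1) and \<open>l\<close> is of order c = k / \<epsilon>, within the
        budget.\<close>
      have "ln (L / \<epsilon>) \<le> ln (1 / \<epsilon> * (1 / \<epsilon>))"
        using L1 L(1) \<epsilon> by (intro ln_mono) (auto simp: field_simps)
      also have "\<dots> = 2 * ln (1 / \<epsilon>)" using \<epsilon> by (subst ln_mult) auto
      also have "\<dots> \<le> 2 * (1 / \<epsilon> - 1)" using \<epsilon> by (intro mult_left_mono ln_le_minus_one) auto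
      finally have "l \<le> real k * (2 / \<epsilon>)"
        unfolding l_def L(3) by (intro mult_left_mono) auto
      then have "2 * l + 3 * \<tau> \<le> 4 * c + 3 * (1 + D)" using \<tau>(2) by (simp add: c_def)
      also have "\<dots> \<le> 7 * Q" using kM k\<epsilon> D\<epsilon> D unfolding Q_def by argo
      also have "\<dots> \<le> real m / 64" using m(2) Q(1) by linarith
      finally have "2 * l + 3 * \<tau> \<le> real m / 64" .
      moreover have "32 * \<epsilon> * real n \<le> 5 * real m"
      proof -
        have "real k * L \<le> real k * (1 / \<epsilon>)" using L1 by (intro mult_left_mono) auto
        then have "\<epsilon> * real n \<le> Q" using Q(2) L(2) by (simp add: c_def)
        then show ?thesis using m(2) Q(1) by simp
      qed
      ultimately obtain R where "?ok m (exp (- \<tau>)) R"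
        using exists_direct_scheme[OF k m(1) \<epsilon>(1) \<tau>(1)] unfolding l_def by blast
      then have "?ok m \<delta> R" using exp\<tau> by auto
      with m_le show ?thesis by blast
    qed
  qed
  then show "\<exists>(m::nat) (R :: (nat \<Rightarrow> real) sensing_scheme).
      is_sensing_scheme m n R \<and>
      real m \<le> 2147483648 * ((real k / \<epsilon>) * max 1 (ln (\<epsilon> * real n / real k)) + (1 / \<epsilon>) * ln (1 / \<delta>)) \<and>
      \<P>((w, x) in seed R \<Otimes>\<^sub>M spiked_covariance n k \<epsilon>.
         l2_l2_guarantee n k \<epsilon> x (estimate m n R w x)) \<ge> 1 - \<delta>"
    unfolding Q_def a_def b_def c_def M_def L_def D_def by blast
qed auto

end
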